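(* Let $w \colon \mathbb{R}^n \to [0,\infty)$ be a weight and let $p \in (0,\infty)$. Then the median maximal operator $\mathcal{M}$ is bounded on $L^p(w)$ (that is, there is a finite constant $C$ such that $\|\mathcal{M}f\|_{L^p(w)} \le C\|f\|_{L^p(w)}$ for all $f \in L^p(w)$) if and only if $w \in A_\infty$.
   Context: Cubes $Q \subset \mathbb{R}^n$ have sides parallel to the coordinate axes and positive finite side-length; $|\cdot|$ is Lebesgue measure. For a measurable function $f \colon Q \to \mathbb{R}$, a number $\alpha \in \mathbb{R}$ is a median of $f$ on $Q$ if $|Q \cap \{f < \alpha\}| \le |Q|/2$ and $|Q \cap \{f > \alpha\}| \le |Q|/2$. The set of medians of $f$ on $Q$ is a nonempty compact interval, and $m_f(Q)$ denotes the median with the largest absolute value (only $|m_f(Q)|$ matters here). The median maximal function of a measurable $f \colon \mathbb{R}^n \to \mathbb{R}$ is $$\mathcal{M}f(x) = \sup_{Q \ni x} |m_f(Q)|,$$ the supremum being over all cubes $Q \subset \mathbb{R}^n$ containing $x$. A weight $w$ is a non-negative measurable function on $\mathbb{R}^n$; $w(E) = \int_E w$ and $\|f\|_{L^p(w)} = (\int |f|^p w)^{1/p}$ (a quasi-norm if $p<1$). One says $w \in A_1$ if $[w]_{A_1} = \sup_Q \frac{w(Q)}{|Q|}\|w^{-1}\|_{L^\infty(Q)} < \infty$. For $1<p<\infty$, $w \in A_p$ if $[w]_{A_p} = \sup_Q \frac{w(Q)}{|Q|}\big(\frac{\sigma(Q)}{|Q|}\big)^{p-1} < \infty$, where $\sigma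 = w^{-1/(p-1)}$. The suprema are over all cubes, with the convention $0\cdot\infty = 0$. Finally $A_\infty = \bigcup_{1 \le p < \infty} A_p$. *)

theory Defs
  imports "HOL-Probability.Essential_Supremum"
begin

text \<open>
  Functions on \<open>\<real>\<^sup>n\<close> are functions on \<^typ>\<open>real ^ 'n\<close>, measurability is Lebesgue measurability, and
  quantities that may be infinite are valued in \<^typ>\<open>ennreal\<close>, where \<open>0 * \<infinity> = 0\<close>.

  Cubes are taken closed. Adding or removing part of the boundary of a cube changes neither its
  measure, nor the medians of a function on it, nor any of the averages below.
\<close>

definition cubes :: "(real ^ 'n) set set" where
  "cubes = {cbox a (\<chi> i. a $ i + l) | a l. 0 < l}"

definition is_median :: "(real ^ 'n \<Rightarrow> real) \<Rightarrow> (real ^ 'n) set \<Rightarrow> real \<Rightarrow> bool" where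
  "is_median f Q \<alpha> \<longleftrightarrow>
     measure lebesgue (Q \<inter> {x. f x < \<alpha>}) \<le> measure lebesgue Q / 2 \<and>
     measure lebesgue (Q \<inter> {x. f x > \<alpha>}) \<le> measure lebesgue Q / 2"

text \<open>If both \<open>\<alpha>\<close> and \<open>-\<alpha>\<close> are medians of largest absolute value, an arbitrary one of
  the two is chosen; only the absolute value is used.\<close>

definition max_median :: "(real ^ 'n \<Rightarrow> real) \<Rightarrow> (real ^ 'n) set \<Rightarrow> real" where
  "max_median f Q = (ARG_MAX abs \<alpha>. is_median f Q \<alpha>)"

definition median_maximal :: "(real ^ 'n \<Rightarrow> real) \<Rightarrow> real ^ 'n \<Rightarrow> ennreal" where
  "median_maximal f x = (SUP Q\<in>{Q \<in> cubes. x \<in> Q}. ennreal \<bar>max_median f Q\<bar>)"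

definition weight :: "(real ^ 'n \<Rightarrow> real) \<Rightarrow> bool" where
  "weight w \<longleftrightarrow> w \<in> borel_measurable lebesgue \<and> (\<forall>x. 0 \<le> w x)"

text \<open>The power \<open>x\<^sup>a\<close> of an extended non-negative number, for exponents \<open>a > 0\<close> only.\<close>

definition ennpowr :: "ennreal \<Rightarrow> real \<Rightarrow> ennreal" where
  "ennpowr x a = (if x = \<infinity> then \<infinity> else ennreal (enn2real x powr a))"

text \<open>The (quasi-)norm is defined for extended-valued functions, since a maximal function may take the
  value \<open>\<infinity>\<close>. Superlevel sets of a maximal function are unions of nondegenerate closed cubes, hence
  Lebesgue measurable, so the integral below is meaningful for it.\<close>

definition Lp_norm :: "(real ^ 'n \<Rightarrow> real) \<Rightarrow> real \<Rightarrow> (real ^ 'n \<Rightarrow> ennreal) \<Rightarrow> ennreal" where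
  "Lp_norm w p g = ennpowr (\<integral>\<^sup>+x. ennpowr (g x) p * ennreal (w x) \<partial>lebesgue) (1 / p)"

definition Lp_space :: "(real ^ 'n \<Rightarrow> real) \<Rightarrow> real \<Rightarrow> (real ^ 'n \<Rightarrow> real) set" where
  "Lp_space w p =
     {f \<in> borel_measurable lebesgue. Lp_norm w p (\<lambda>x. ennreal \<bar>f x\<bar>) < \<infinity>}"

definition average :: "(real ^ 'n \<Rightarrow> ennreal) \<Rightarrow> (real ^ 'n) set \<Rightarrow> ennreal" where
  "average g Q = (\<integral>\<^sup>+x\<in>Q. g x \<partial>lebesgue) / emeasure lebesgue Q"

text \<open>Negative powers of \<open>w\<close> are powers of the \<^typ>\<open>ennreal\<close> reciprocal, so they are \<open>\<infinity>\<close> where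
  \<open>w\<close> vanishes.\<close>

definition dual_weight :: "real \<Rightarrow> (real ^ 'n \<Rightarrow> real) \<Rightarrow> real ^ 'n \<Rightarrow> ennreal" where
  "dual_weight p w x = ennpowr (inverse (ennreal (w x))) (1 / (p - 1))"

definition A1_const :: "(real ^ 'n \<Rightarrow> real) \<Rightarrow> ennreal" where
  "A1_const w =
     (SUP Q\<in>cubes. average (\<lambda>x. ennreal (w x)) Q *
        esssup (restrict_space lebesgue Q) (\<lambda>x. inverse (ennreal (w x))))"

definition Ap_const :: "real \<Rightarrow> (real ^ 'n \<Rightarrow> real) \<Rightarrow> ennreal" where
  "Ap_const p w =
     (SUP Q\<in>cubes. average (\<lambda>x. ennreal (w x)) Q *
        ennpowr (average (dual_weight p w) Q) (p - 1))"

definition A_class :: "real \<Rightarrow> (real ^ 'n \<Rightarrow> real) set" where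
  "A_class p = {w. weight w \<and> (if p = 1 then A1_const w else Ap_const p w) < \<infinity>}"

definition A_infinity :: "(real ^ 'n \<Rightarrow> real) set" where
  "A_infinity = (\<Union>p\<in>{1..}. A_class p)"

end

theory Submission
  imports Defs
begin

text \<open>
  Both sides of the equivalence amount to one condition on the weight, \<open>comparable_on_halves\<close>: the
  weighted measure of a cube is at most \<open>K\<close> times that of any subset filling at least half of the
  cube in Lebesgue measure.

  Boundedness gives the condition at once. If \<open>E\<close> fills half of \<open>Q\<close>, then \<open>1\<close> is a median of the
  indicator of \<open>E\<close> on \<open>Q\<close>, so its maximal function is at least \<open>1\<close> on \<open>Q\<close>, and the norm inequality for
  this function compares \<open>w(Q)\<close> with \<open>w(E)\<close> (\<open>bounded_imp_comparable_on_halves\<close>).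

  For the converse, if a median of \<open>f\<close> on \<open>Q\<close> exceeds \<open>s\<close> in absolute value, then \<open>\<bar>f\<bar> > s\<close> on at least half
  of \<open>Q\<close>. So the superlevel set of the maximal function at level \<open>s\<close> is a union of cubes each of which has
  weighted measure at most \<open>K\<close> times that of its part in \<open>{\<bar>f\<bar> > s}\<close>. The condition also implies that the
  weighted measure is doubling (\<open>weighted_cube_doubling\<close>), so that Vitali's covering argument bounds
  the superlevel set by \<open>{\<bar>f\<bar> > s}\<close> (\<open>weighted_open_cover\<close>). The levels on both sides agree, unlike for
  the Hardy-Littlewood operator, and therefore summation over dyadic levels gives the strong inequality
  for every exponent (\<open>comparable_on_halves_imp_bounded\<close>).

  It remains to compare the condition with \<open>A\<^sub>\<infinity>\<close>. From \<open>A\<^sub>p\<close> it follows by Chebyshev's inequality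
  for the dual weight, or from the bound on \<open>1 / w\<close> if \<open>p = 1\<close>
  (\<open>A_infinity_imp_comparable_on_halves\<close>). The opposite implication is the substantial one: a
  stopping-time argument in the dyadic subcubes shows that the part of a cube where \<open>w\<close> is less than
  \<open>d ^ k\<close> times its mean has at most \<open>(1/2) ^ k\<close> of the measure of the cube
  (\<open>emeasure_sublevel_decay\<close>). Hence a small negative power of \<open>w\<close> is integrable with the right
  bound, which is the \<open>A\<^sub>p\<close> condition for a large \<open>p\<close> (\<open>comparable_on_halves_imp_A_infinity\<close>).
\<close>

section \<open>Extended non-negative numbers and countable unions\<close>

lemma ennreal_eq_top_if_of_nat_le:
  assumes "\<And>n. of_nat n \<le> (x :: ennreal)"
  shows "x = top"
proof (rule ccontr)
  assume "x \<noteq> top"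
  then obtain n where "x < of_nat n"
    using ennreal_Ex_less_of_nat by (auto simp: less_top)
  with assms[of n] show False by simp
qed

lemma ennreal_le_suminf: "f j \<le> (\<Sum>i. f i :: ennreal)"
  using sum_le_suminf[of f "{j}"] by simp

lemma ennpowr_ennreal: "0 \<le> r \<Longrightarrow> ennpowr (ennreal r) a = ennreal (r powr a)"
  by (simp add: ennpowr_def)

lemma ennpowr_mono: "x \<le> y \<Longrightarrow> 0 < a \<Longrightarrow> ennpowr x a \<le> ennpowr y a"
  by (cases x; cases y) (auto simp: ennpowr_def top_unique intro!: ennreal_leI powr_mono2)

lemma ennpowr_mult:
  assumes "0 < a"
  shows "ennpowr (x * y) a = ennpowr x a * ennpowr y a"
proof (cases x; cases y)
  fix r s :: real
  assume "0 \<le> r" "x = ennreal r" "0 \<le> s" "y = ennreal s"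
  then show ?thesis
    by (simp add: ennpowr_ennreal flip: ennreal_mult) (simp add: powr_mult ennreal_mult)
qed (use assms in \<open>auto simp: ennpowr_def ennreal_mult_eq_top_iff ennreal_top_mult ennreal_mult_top powr_def split: if_splits\<close>)

lemma ennpowr_ennpowr:
  assumes "a * b = 1"
  shows "ennpowr (ennpowr x a) b = x"
proof (cases x)
  case (real r)
  then show ?thesis using assms by (simp add: ennpowr_ennreal powr_powr)
qed (simp add: ennpowr_def)

lemma measurable_ennpowr [measurable]: "(\<lambda>x. ennpowr x a) \<in> borel_measurable borel"
  unfolding ennpowr_def by measurable

lemma ennreal_less_ennpowr_iff:
  assumes "0 < t" "0 < p"
  shows "ennreal t < ennpowr y p \<longleftrightarrow> ennreal (t powr (1 / p)) < y"
proof (cases y)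
  case (real r)
  have "t < r powr p \<longleftrightarrow> t powr (1 / p) < r"
  proof
    assume "t < r powr p"
    then have "t powr (1 / p) < (r powr p) powr (1 / p)"
      using assms by (intro powr_less_mono2) auto
    then show "t powr (1 / p) < r" using assms real by (simp add: powr_powr)
  next
    assume "t powr (1 / p) < r"
    then have "(t powr (1 / p)) powr p < r powr p"
      using assms by (intro powr_less_mono2) auto
    then show "t < r powr p" using assms real by (simp add: powr_powr)
  qed
  then show ?thesis
    using assms real by (simp add: ennpowr_ennreal ennreal_less_iff)
qed (simp add: ennpowr_def)

lemma emeasure_countable_UN_le:
  assumes "countable I" "\<And>i. i \<in> I \<Longrightarrow> A i \<in> sets M"
    "\<And>F. finite F \<Longrightarrow> F \<subseteq> I \<Longrightarrow> emeasure M (\<Union>i\<in>F. A i) \<le> c"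
  shows "emeasure M (\<Union>i\<in>I. A i) \<le> c"
proof (cases "I = {}")
  case False
  define B where "B n = (\<Union>i\<in>from_nat_into I ` {..n}. A i)" for n
  have I: "from_nat_into I ` {..n} \<subseteq> I" for n
    using False by (auto intro: from_nat_into)
  have "emeasure M (B n) \<le> c" for n
    unfolding B_def using I by (intro assms(3)) auto
  moreover have "(SUP n. emeasure M (B n)) = emeasure M (\<Union>n. B n)"
  proof (rule SUP_emeasure_incseq)
    show "range B \<subseteq> sets M"
      using I assms(2) by (auto simp: B_def intro!: sets.finite_UN)
    show "incseq B"
      by (force simp: incseq_def B_def)
  qed
  moreover have "(\<Union>n. B n) = (\<Union>i\<in>I. A i)"
  proof -
    have "range (from_nat_into I) = I"
      using False assms(1) by (simp add: range_from_nat_into)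
    moreover have "(\<Union>n. B n) = (\<Union>i\<in>range (from_nat_into I). A i)"
      by (auto simp: B_def)
    ultimately show ?thesis by simp
  qed
  ultimately show ?thesis
    by (metis SUP_least)
qed simp

lemma emeasure_disjoint_UN_le:
  assumes "countable I" "\<And>i. i \<in> I \<Longrightarrow> A i \<in> sets M" "\<And>i. i \<in> I \<Longrightarrow> B i \<in> sets N"
    and "disjoint_family_on A I" "disjoint_family_on B I"
    and le: "\<And>i. i \<in> I \<Longrightarrow> emeasure N (B i) \<le> C * emeasure M (A i)"
  shows "emeasure N (\<Union>i\<in>I. B i) \<le> C * emeasure M (\<Union>i\<in>I. A i)"
proof -
  have "emeasure N (\<Union>i\<in>I. B i) = (\<integral>\<^sup>+i. emeasure N (B i) \<partial>count_space I)"
    using assms by (intro emeasure_UN_countable) auto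
  also have "\<dots> \<le> (\<integral>\<^sup>+i. C * emeasure M (A i) \<partial>count_space I)"
    by (intro nn_integral_mono) (simp add: le)
  also have "\<dots> = C * (\<integral>\<^sup>+i. emeasure M (A i) \<partial>count_space I)"
    by (rule nn_integral_cmult) simp
  also have "(\<integral>\<^sup>+i. emeasure M (A i) \<partial>count_space I) = emeasure M (\<Union>i\<in>I. A i)"
    using assms by (intro emeasure_UN_countable[symmetric]) auto
  finally show ?thesis .
qed

section \<open>Cubes\<close>

definition cube :: "real ^ 'n \<Rightarrow> real \<Rightarrow> (real ^ 'n) set" where
  "cube a l = cbox a (\<chi> i. a $ i + l)"

lemma cubes_eq: "cubes = {cube a l |a l. 0 < l}"
  by (simp add: cubes_def cube_def)

lemma cube_in_cubes: "0 < l \<Longrightarrow> cube a l \<in> cubes"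
  by (auto simp: cubes_eq)

lemma mem_cube: "x \<in> cube a l \<longleftrightarrow> (\<forall>i. a $ i \<le> x $ i \<and> x $ i \<le> a $ i + l)"
  by (simp add: cube_def mem_box_cart)

lemma cube_sets [measurable, simp]: "cube a l \<in> sets lebesgue"
  by (simp add: cube_def)

lemma measure_cube:
  fixes a :: "real ^ 'n"
  assumes "0 \<le> l"
  shows "measure lebesgue (cube a l) = l ^ CARD('n)"
proof -
  have "a \<in> cbox a (\<chi> i. a $ i + l)"
    using assms by (simp add: mem_box_cart)
  then have "cbox a (\<chi> i. a $ i + l) \<noteq> {}"
    by blast
  then show ?thesis
    by (simp add: cube_def content_cbox_if_cart)
qed

lemma cube_lmeasurable [simp]: "cube a l \<in> lmeasurable"
  by (simp add: cube_def)

lemma emeasure_cube: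
  fixes a :: "real ^ 'n"
  assumes "0 \<le> l"
  shows "emeasure lebesgue (cube a l) = ennreal (l ^ CARD('n))"
  using assms by (simp add: emeasure_eq_measure2 measure_cube)

lemma cube_subset_iff:
  assumes "0 \<le> l"
  shows "cube a l \<subseteq> cube b m \<longleftrightarrow> (\<forall>i. b $ i \<le> a $ i \<and> a $ i + l \<le> b $ i + m)"
proof
  assume *: "cube a l \<subseteq> cube b m"
  have "a \<in> cube a l" "(\<chi> i. a $ i + l) \<in> cube a l"
    using assms by (auto simp: mem_cube)
  with * have "a \<in> cube b m" "(\<chi> i. a $ i + l) \<in> cube b m" by auto
  then show "\<forall>i. b $ i \<le> a $ i \<and> a $ i + l \<le> b $ i + m"
    by (auto simp: mem_cube)
next
  assume *: "\<forall>i. b $ i \<le> a $ i \<and> a $ i + l \<le> b $ i + m"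
  show "cube a l \<subseteq> cube b m"
  proof
    fix x assume x: "x \<in> cube a l"
    show "x \<in> cube b m"
      unfolding mem_cube
    proof
      fix i
      from x * have "a $ i \<le> x $ i" "x $ i \<le> a $ i + l" "b $ i \<le> a $ i" "a $ i + l \<le> b $ i + m"
        by (auto simp: mem_cube)
      then show "b $ i \<le> x $ i \<and> x $ i \<le> b $ i + m" by linarith
    qed
  qed
qed

lemma cube_subset_side:
  assumes "0 \<le> l" "cube a l \<subseteq> cube b m"
  shows "l \<le> m"
proof -
  fix i
  have "b $ i \<le> a $ i \<and> a $ i + l \<le> b $ i + m"
    using assms by (simp add: cube_subset_iff)
  then show ?thesis by linarith
qed

section \<open>Doubling\<close>

abbreviation weighted :: "(real ^ 'n \<Rightarrow> real) \<Rightarrow> (real ^ 'n) measure" where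
  "weighted w \<equiv> density lebesgue (\<lambda>x. ennreal (w x))"

text \<open>
  The quantitative form of \<open>A\<^sub>\<infinity>\<close> to which both sides of the equivalence are reduced: no subset that
  is large for Lebesgue measure is small for the weighted measure. The normalization \<open>1 \<le> K\<close> makes
  the powers of \<open>K\<close> that arise from iteration increasing.
\<close>

definition comparable_on_halves :: "(real ^ 'n \<Rightarrow> real) \<Rightarrow> real \<Rightarrow> bool" where
  "comparable_on_halves w K \<longleftrightarrow> 1 \<le> K \<and>
     (\<forall>Q\<in>cubes. \<forall>E\<in>sets lebesgue. E \<subseteq> Q \<and> measure lebesgue Q / 2 \<le> measure lebesgue E \<longrightarrow>
        emeasure (weighted w) Q \<le> ennreal K * emeasure (weighted w) E)"

lemma comparable_on_halvesD:
  assumes "comparable_on_halves w K" "Q \<in> cubes" "E \<in> sets lebesgue" "E \<subseteq> Q"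
    "measure lebesgue Q / 2 \<le> measure lebesgue E"
  shows "emeasure (weighted w) Q \<le> ennreal K * emeasure (weighted w) E"
  using assms by (auto simp: comparable_on_halves_def)

text \<open>
  Moving the corner linearly with the side-length keeps all inclusions: in every coordinate the lower
  end decreases and the upper end increases along the way from the small cube to the large one.
\<close>

lemma cubes_between:
  fixes a A :: "real ^ 'n"
  assumes "0 < l" "l \<le> s" "s \<le> L" "l < L" "cube a l \<subseteq> cube A L"
  obtains b where "cube a l \<subseteq> cube b s" "cube b s \<subseteq> cube A L"
proof
  define t where "t = (s - l) / (L - l)"
  define b where "b = (\<chi> i. a $ i + t * (A $ i - a $ i))"
  have t: "0 \<le> t" "t \<le> 1" "t * (L - l) = s - l"
    using assms by (auto simp: t_def field_simps)
  have A: "A $ i - a $ i \<le> 0" "0 \<le> L - l + (A $ i - a $ i)" for i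
    using assms(5) \<open>0 < l\<close> by (auto simp: cube_subset_iff algebra_simps)
  have 1: "t * (A $ i - a $ i) \<le> 0" "0 \<le> t * (L - l + (A $ i - a $ i))"
    "(1 - t) * (A $ i - a $ i) \<le> 0" "0 \<le> (1 - t) * (L - l + (A $ i - a $ i))" for i
    using t A[of i] by (auto intro: mult_nonneg_nonneg mult_nonneg_nonpos)
  have 2: "t * (L - l + (A $ i - a $ i)) = s - l + t * (A $ i - a $ i)"
    "(1 - t) * (A $ i - a $ i) = A $ i - a $ i - t * (A $ i - a $ i)"
    "(1 - t) * (L - l + (A $ i - a $ i)) = L - s + (A $ i - a $ i - t * (A $ i - a $ i))" for i
    using t(3) by (simp_all add: algebra_simps)
  have "b $ i = a $ i + t * (A $ i - a $ i)" for i
    by (simp add: b_def)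
  with 1[unfolded 2] have "b $ i \<le> a $ i \<and> a $ i + l \<le> b $ i + s"
    "A $ i \<le> b $ i \<and> b $ i + s \<le> A $ i + L" for i
    by (smt (verit))+
  then show "cube a l \<subseteq> cube b s" "cube b s \<subseteq> cube A L"
    using \<open>0 < l\<close> \<open>l \<le> s\<close> by (auto simp: cube_subset_iff)
qed

text \<open>
  A cube of side \<open>2 powr (1/n)\<close> times that of a smaller cube inside it has exactly twice its
  measure, so the smaller cube is an admissible half of it. A chain of such cubes between
  \<open>cube a l\<close> and \<open>cube A L\<close> costs a factor \<open>K\<close> at each link.
\<close>

lemma comparable_on_halves_chain:
  fixes a A :: "real ^ 'n"
  assumes w: "comparable_on_halves w K"
    and "0 < l" "cube a l \<subseteq> cube A L" "L ^ CARD('n) \<le> 2 ^ Suc m * l ^ CARD('n)"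
  shows "emeasure (weighted w) (cube A L) \<le> ennreal (K ^ Suc m) * emeasure (weighted w) (cube a l)"
  using assms(2-)
proof (induction m arbitrary: a l)
  have half: "emeasure (weighted w) (cube B M) \<le> ennreal K * emeasure (weighted w) (cube b r)"
    if "0 < r" "cube b r \<subseteq> cube B M" "M ^ CARD('n) \<le> 2 * r ^ CARD('n)" for B b :: "real ^ 'n" and M r
  proof -
    have "r \<le> M"
      using that cube_subset_side less_imp_le by blast
    then show ?thesis
      using that by (intro comparable_on_halvesD[OF w]) (auto simp: cube_in_cubes measure_cube)
  qed
  {
    case 0
    then show ?case using half[of l a A L] by simp
  next
    case (Suc m)
    have K: "1 \<le> K" using w by (simp add: comparable_on_halves_def)
    show ?case
    proof (cases "L ^ CARD('n) \<le> 2 * l ^ CARD('n)")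
      case True
      have "K * 1 \<le> K * K ^ Suc m"
        using K by (intro mult_left_mono one_le_power) auto
      then have "ennreal K * emeasure (weighted w) (cube a l)
          \<le> ennreal (K ^ Suc (Suc m)) * emeasure (weighted w) (cube a l)"
        by (intro mult_right_mono ennreal_leI) auto
      with half[of l a A L] True Suc.prems show ?thesis by (meson order_trans)
    next
      case False
      \<comment> \<open>The side for which the Lebesgue measure doubles.\<close>
      define s where "s = root CARD('n) 2 * l"
      have s: "s ^ CARD('n) = 2 * l ^ CARD('n)"
        by (simp add: s_def power_mult_distrib)
      have "0 < s" using Suc.prems by (simp add: s_def)
      have "1 \<le> root CARD('n) 2"
        by simp
      then have "l \<le> s"
        using Suc.prems mult_right_mono[of 1 "root CARD('n) 2" l] by (simp add: s_def)
      have "l \<le> L"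
        using Suc.prems cube_subset_side less_imp_le by blast
      have "s < L"
        using False s \<open>l \<le> L\<close> \<open>0 < l\<close> by (intro power_less_imp_less_base[of s "CARD('n)" L]) auto
      obtain b where b: "cube a l \<subseteq> cube b s" "cube b s \<subseteq> cube A L"
        using cubes_between[of l s L a A] Suc.prems \<open>l \<le> s\<close> \<open>s < L\<close> by (metis less_imp_le order_le_less_trans)
      have "emeasure (weighted w) (cube A L) \<le> ennreal (K ^ Suc m) * emeasure (weighted w) (cube b s)"
        using Suc.prems by (intro Suc.IH \<open>0 < s\<close> b) (simp add: s)
      also have "\<dots> \<le> ennreal (K ^ Suc m) * (ennreal K * emeasure (weighted w) (cube a l))"
        using half[OF \<open>0 < l\<close> b(1)] s by (intro mult_left_mono) auto
      finally show ?thesis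
        using K by (simp add: ennreal_mult mult_ac)
    qed
  }
qed

text \<open>
  The doubling property, for a small cube anywhere inside the large one: one factor \<open>2\<close> of side-length is
  \<open>n\<close> doublings of measure.
\<close>

lemma weighted_cube_doubling:
  fixes a A :: "real ^ 'n"
  assumes "comparable_on_halves w K"
    and "0 < l" "cube a l \<subseteq> cube A L" "L \<le> 2 ^ j * l" "0 < j"
  shows "emeasure (weighted w) (cube A L) \<le> ennreal (K ^ (j * CARD('n))) * emeasure (weighted w) (cube a l)"
proof -
  have "l \<le> L"
    using assms cube_subset_side less_imp_le by blast
  obtain m where m: "j * CARD('n) = Suc m"
    using \<open>0 < j\<close> by (metis not0_implies_Suc mult_is_0 less_not_refl zero_less_card_finite)
  have "L ^ CARD('n) \<le> (2 ^ j * l) ^ CARD('n)"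
    using assms \<open>l \<le> L\<close> by (intro power_mono) auto
  also have "\<dots> = 2 ^ Suc m * l ^ CARD('n)"
    by (simp add: power_mult_distrib flip: m power_mult)
  finally show ?thesis
    unfolding m by (intro comparable_on_halves_chain assms)
qed

section \<open>Covering by cubes\<close>

text \<open>
  Vitali selection: pick a cube of largest side, discard all cubes that meet it, and repeat. A
  discarded cube meets a selected one of at least its own side, so tripling the latter about its
  centre swallows it.
\<close>

lemma cubes_Vitali_finite:
  fixes a :: "'i \<Rightarrow> real ^ 'n"
  assumes "finite F" "\<And>i. i \<in> F \<Longrightarrow> 0 < l i"
  shows "\<exists>G\<subseteq>F. disjoint_family_on (\<lambda>i. cube (a i) (l i)) G \<and>
    (\<Union>i\<in>F. cube (a i) (l i)) \<subseteq> (\<Union>i\<in>G. cube (\<chi> j. a i $ j - l i) (3 * l i))"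
  using assms
proof (induction F rule: finite_psubset_induct)
  case (psubset F)
  show ?case
  proof (cases "F = {}")
    case True
    then show ?thesis by (auto simp: disjoint_family_on_def)
  next
    case False
    then obtain m where m: "m \<in> F" "\<And>i. i \<in> F \<Longrightarrow> l i \<le> l m"
      using psubset.hyps Max_in[of "l ` F"] Max_ge[of "l ` F"]
      by (metis (no_types, lifting) finite_imageI image_iff image_is_empty image_eqI)
    define F' where "F' = {i \<in> F. cube (a i) (l i) \<inter> cube (a m) (l m) = {}}"
    have "a m \<in> cube (a m) (l m)"
      using psubset.prems[OF m(1)] by (simp add: mem_cube)
    then have "F' \<subset> F"
      using m(1) by (auto simp: F'_def)
    then obtain G where G: "G \<subseteq> F'" "disjoint_family_on (\<lambda>i. cube (a i) (l i)) G"
      "(\<Union>i\<in>F'. cube (a i) (l i)) \<subseteq> (\<Union>i\<in>G. cube (\<chi> j. a i $ j - l i) (3 * l i))"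
      using psubset.IH[of F'] psubset.prems by blast
    have near: "cube (a i) (l i) \<subseteq> cube (\<chi> j. a m $ j - l m) (3 * l m)" if i: "i \<in> F - F'" for i
    proof -
      obtain y where "y \<in> cube (a i) (l i)" "y \<in> cube (a m) (l m)"
        using i by (auto simp: F'_def)
      then have "a i $ j \<le> y $ j \<and> y $ j \<le> a i $ j + l i \<and> a m $ j \<le> y $ j \<and> y $ j \<le> a m $ j + l m" for j
        by (simp add: mem_cube)
      moreover have "0 < l i" "l i \<le> l m" using i m psubset.prems by auto
      ultimately have "a m $ j - l m \<le> a i $ j \<and> a i $ j + l i \<le> a m $ j - l m + 3 * l m" for j
        by (smt (verit))
      then show ?thesis
        using \<open>0 < l i\<close> by (simp add: cube_subset_iff)
    qed
    have "disjoint_family_on (\<lambda>i. cube (a i) (l i)) (insert m G)"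
      using G(1,2) unfolding disjoint_family_on_def F'_def by blast
    moreover have "(\<Union>i\<in>F. cube (a i) (l i)) \<subseteq> (\<Union>i\<in>insert m G. cube (\<chi> j. a i $ j - l i) (3 * l i))"
      using G(3) near by blast
    moreover have "insert m G \<subseteq> F"
      using G(1) m(1) by (auto simp: F'_def)
    ultimately show ?thesis by blast
  qed
qed

text \<open>
  Vitali selection is applied to the doubled cubes, since it is those that have to be covered. The
  selected doubles are disjoint, hence so are the original cubes inside them, and the parts of \<open>S\<close> in
  these can be added up. Doubling and tripling multiply the side by \<open>6 \<le> 2\<^sup>3\<close>, which
  accounts for the exponent \<open>3 * n\<close>; one more factor \<open>K\<close> is the hypothesis on the cubes.
\<close>

lemma weighted_finite_cover:
  fixes w :: "real ^ 'n \<Rightarrow> real"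
  assumes w: "comparable_on_halves w K" and S: "S \<in> sets lebesgue" and "finite F"
    and F: "\<And>a l. (a, l) \<in> F \<Longrightarrow> 0 < l"
      "\<And>a l. (a, l) \<in> F \<Longrightarrow> emeasure (weighted w) (cube a l) \<le> ennreal K * emeasure (weighted w) (cube a l \<inter> S)"
  shows "emeasure (weighted w) (\<Union>(a, l)\<in>F. cube (\<chi> j. a $ j - l / 2) (2 * l))
    \<le> ennreal (K ^ (3 * CARD('n) + 1)) * emeasure (weighted w) S"
proof -
  define A :: "(real ^ 'n) \<times> real \<Rightarrow> real ^ 'n" where "A p = (\<chi> j. fst p $ j - snd p / 2)" for p
  define T where "T p = cube (\<chi> j. A p $ j - 2 * snd p) (3 * (2 * snd p))" for p
  define c where "c p = cube (fst p) (snd p)" for p :: "(real ^ 'n) \<times> real"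
  have K: "1 \<le> K" using w by (simp add: comparable_on_halves_def)
  have pos: "0 < snd p" if "p \<in> F" for p
    using F(1) that by (cases p) auto
  obtain G where G: "G \<subseteq> F" "disjoint_family_on (\<lambda>p. cube (A p) (2 * snd p)) G"
    "(\<Union>p\<in>F. cube (A p) (2 * snd p)) \<subseteq> (\<Union>p\<in>G. T p)"
    using cubes_Vitali_finite[OF \<open>finite F\<close>, of "\<lambda>p. 2 * snd p" A] pos unfolding T_def by auto
  have "finite G" using G(1) \<open>finite F\<close> finite_subset by blast
  have T: "emeasure (weighted w) (T p) \<le> ennreal (K ^ (3 * CARD('n))) * emeasure (weighted w) (c p)" if "p \<in> G" for p
  proof -
    have "0 < snd p" using pos that G(1) by blast
    then show ?thesis
      unfolding T_def c_def by (intro weighted_cube_doubling[OF w]) (simp_all add: cube_subset_iff A_def)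
  qed
  have sub: "c p \<subseteq> cube (A p) (2 * snd p)" if "p \<in> G" for p
  proof -
    have "0 < snd p" using pos that G(1) by blast
    then show ?thesis by (simp add: c_def cube_subset_iff A_def)
  qed
  have disj: "disjoint_family_on (\<lambda>p. c p \<inter> S) G"
    using G(2) sub unfolding disjoint_family_on_def by blast
  have [measurable]: "c p \<in> sets lebesgue" "T p \<in> sets lebesgue" for p
    by (auto simp: c_def T_def)
  have "emeasure (weighted w) (\<Union>(a, l)\<in>F. cube (\<chi> j. a $ j - l / 2) (2 * l))
      = emeasure (weighted w) (\<Union>p\<in>F. cube (A p) (2 * snd p))"
    by (simp add: A_def case_prod_unfold)
  also have "\<dots> \<le> emeasure (weighted w) (\<Union>p\<in>G. T p)"
    using G(3) \<open>finite G\<close> by (intro emeasure_mono) auto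
  also have "\<dots> \<le> (\<Sum>p\<in>G. emeasure (weighted w) (T p))"
    using \<open>finite G\<close> by (intro emeasure_subadditive_finite) auto
  also have "\<dots> \<le> (\<Sum>p\<in>G. ennreal (K ^ (3 * CARD('n))) * (ennreal K * emeasure (weighted w) (c p \<inter> S)))"
  proof (rule sum_mono)
    fix p assume "p \<in> G"
    then have "emeasure (weighted w) (c p) \<le> ennreal K * emeasure (weighted w) (c p \<inter> S)"
      using F(2)[of "fst p" "snd p"] G(1) by (auto simp: c_def)
    with T[OF \<open>p \<in> G\<close>] show "emeasure (weighted w) (T p)
        \<le> ennreal (K ^ (3 * CARD('n))) * (ennreal K * emeasure (weighted w) (c p \<inter> S))"
      by (meson mult_left_mono order_trans zero_le)
  qed
  also have "\<dots> = ennreal (K ^ (3 * CARD('n) + 1)) * (\<Sum>p\<in>G. emeasure (weighted w) (c p \<inter> S))"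
    using K by (simp add: sum_distrib_left ennreal_mult mult_ac)
  also have "(\<Sum>p\<in>G. emeasure (weighted w) (c p \<inter> S)) = emeasure (weighted w) (\<Union>p\<in>G. c p \<inter> S)"
    using \<open>finite G\<close> S disj by (intro sum_emeasure) auto
  also have "\<dots> \<le> emeasure (weighted w) S"
    using S by (intro emeasure_mono) auto
  finally show ?thesis by (simp add: mult_left_mono)
qed

text \<open>
  An arbitrary union of closed cubes is enclosed in the union of their open doubles. The latter is
  open, hence measurable, and by Lindelof's theorem and continuity from below its measure is
  controlled by finite subfamilies.
\<close>

lemma weighted_open_cover:
  fixes w :: "real ^ 'n \<Rightarrow> real"
  assumes w: "comparable_on_halves w K" and S: "S \<in> sets lebesgue"
    and \<Q>: "\<Q> \<subseteq> cubes" "\<And>Q. Q \<in> \<Q> \<Longrightarrow> emeasure (weighted w) Q \<le> ennreal K * emeasure (weighted w) (Q \<inter> S)"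
  obtains G where "open G" "\<Union>\<Q> \<subseteq> G"
    "emeasure (weighted w) G \<le> ennreal (K ^ (3 * CARD('n) + 1)) * emeasure (weighted w) S"
proof -
  define I where "I = {(a, l). 0 < l \<and> cube a l \<in> \<Q>}"
  define B :: "(real ^ 'n) \<times> real \<Rightarrow> (real ^ 'n) set"
    where "B p = box (\<chi> j. fst p $ j - snd p / 2) (\<chi> j. fst p $ j + 3 / 2 * snd p)" for p
  have B: "B p \<subseteq> cube (\<chi> j. fst p $ j - snd p / 2) (2 * snd p)" for p
  proof
    fix x assume x: "x \<in> B p"
    show "x \<in> cube (\<chi> j. fst p $ j - snd p / 2) (2 * snd p)"
      unfolding mem_cube
    proof
      fix i
      from x have "fst p $ i - snd p / 2 < x $ i" "x $ i < fst p $ i + 3 / 2 * snd p"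
        by (simp_all add: B_def mem_box_cart)
      then show "(\<chi> j. fst p $ j - snd p / 2) $ i \<le> x $ i \<and>
          x $ i \<le> (\<chi> j. fst p $ j - snd p / 2) $ i + 2 * snd p"
        by simp
    qed
  qed
  obtain \<F> where "\<F> \<subseteq> B ` I" "countable \<F>" and \<F>: "\<Union>\<F> = (\<Union>p\<in>I. B p)"
    using Lindelof[of "B ` I"] by (auto simp: B_def)
  then obtain J where J: "J \<subseteq> I" "countable J" "\<F> = B ` J"
    by (metis countable_subset_image)
  have "\<Union>\<Q> \<subseteq> (\<Union>p\<in>I. B p)"
  proof
    fix x assume "x \<in> \<Union>\<Q>"
    then obtain a l where al: "0 < l" "cube a l \<in> \<Q>" "x \<in> cube a l"
      using \<Q>(1) by (auto simp: cubes_eq)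
    have "x \<in> B (a, l)"
      unfolding B_def mem_box_cart
    proof
      fix i
      have "a $ i \<le> x $ i" "x $ i \<le> a $ i + l"
        using al by (auto simp: mem_cube)
      then show "(\<chi> j. fst (a, l) $ j - snd (a, l) / 2) $ i < x $ i \<and>
          x $ i < (\<chi> j. fst (a, l) $ j + 3 / 2 * snd (a, l)) $ i"
        using al(1) by simp
    qed
    then show "x \<in> (\<Union>p\<in>I. B p)"
      using al by (auto simp: I_def)
  qed
  moreover have "emeasure (weighted w) (\<Union>p\<in>J. B p) \<le> ennreal (K ^ (3 * CARD('n) + 1)) * emeasure (weighted w) S"
  proof (rule emeasure_countable_UN_le[OF \<open>countable J\<close>])
    fix F assume F: "finite F" "F \<subseteq> J"
    have "emeasure (weighted w) (\<Union>p\<in>F. B p)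
        \<le> emeasure (weighted w) (\<Union>(a, l)\<in>F. cube (\<chi> j. a $ j - l / 2) (2 * l))"
      using F(1) B by (intro emeasure_mono) (auto simp: case_prod_unfold)
    also have "\<dots> \<le> ennreal (K ^ (3 * CARD('n) + 1)) * emeasure (weighted w) S"
      using F J(1) \<Q>(2) by (intro weighted_finite_cover w S) (auto simp: I_def)
    finally show "emeasure (weighted w) (\<Union>p\<in>F. B p) \<le> \<dots>" .
  qed (auto simp: B_def)
  moreover have "open (\<Union>p\<in>I. B p)"
    by (auto simp: B_def)
  ultimately show thesis
    using that \<F> J(3) by simp
qed

section \<open>From weak type to integrals\<close>

lemma sum_two_powi_le:
  fixes b :: int
  assumes "finite F" "\<And>k. k \<in> F \<Longrightarrow> k < b"
  shows "(\<Sum>k\<in>F. 2 powi k) \<le> (2 powi b :: real)"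
  using assms
proof (induction F arbitrary: b rule: finite_linorder_max_induct)
  case (insert m F)
  have "(\<Sum>k\<in>insert m F. 2 powi k) = 2 powi m + (\<Sum>k\<in>F. 2 powi k :: real)"
    using insert.hyps by (subst sum.insert) auto
  also have "\<dots> \<le> 2 powi m + 2 powi m"
    using insert.IH[of m] insert.hyps by auto
  also have "\<dots> = 2 powi (m + 1)"
    by (simp add: power_int_add)
  also have "\<dots> \<le> 2 powi b"
    using insert.prems[of m] by (intro power_int_increasing) auto
  finally show ?case .
qed simp

text \<open>
  The sum of all integer powers of \<open>2\<close> below \<open>y\<close>, a discrete substitute for the layer-cake formula:
  it is comparable to \<open>y\<close>, and \<open>dyadic_sum (g x)\<close> is a countable combination of the indicators of the
  superlevel sets of \<open>g\<close>. The exponents run through the integers by means of \<open>int_decode\<close>.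
\<close>

definition dyadic_sum :: "ennreal \<Rightarrow> ennreal" where
  "dyadic_sum y = (\<Sum>i. if ennreal (2 powi int_decode i) < y then ennreal (2 powi int_decode i) else 0)"

lemma dyadic_sum_le: "dyadic_sum y \<le> 2 * y"
proof (cases y)
  case (real r)
  show ?thesis
    unfolding dyadic_sum_def
  proof (rule suminf_le_const[OF summableI])
    fix n
    define F where "F = int_decode ` {i. i < n \<and> ennreal (2 powi int_decode i) < y}"
    have "inj_on int_decode {i. i < n \<and> ennreal (2 powi int_decode i) < y}"
      by (meson bij_int_decode bij_is_inj inj_on_subset subset_UNIV)
    then have "(\<Sum>i<n. if ennreal (2 powi int_decode i) < y then ennreal (2 powi int_decode i) else 0)
        = (\<Sum>k\<in>F. ennreal (2 powi k))"
      unfolding F_def by (subst sum.reindex) (auto simp: sum.inter_filter[symmetric])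
    also have "\<dots> = ennreal (\<Sum>k\<in>F. 2 powi k)"
      by (simp add: sum_ennreal)
    also have "\<dots> \<le> ennreal (2 * r)"
    proof (cases "F = {}")
      case False
      have "finite F" by (simp add: F_def)
      have "(\<Sum>k\<in>F. 2 powi k) \<le> (2 powi (Max F + 1) :: real)"
        using Max_ge[OF \<open>finite F\<close>] by (intro sum_two_powi_le \<open>finite F\<close>) (simp add: zle_add1_eq_le)
      moreover have "Max F \<in> F" using \<open>finite F\<close> False by simp
      then have "(2 powi Max F :: real) < r"
        using real by (auto simp: F_def ennreal_less_iff)
      ultimately show ?thesis
        by (intro ennreal_leI) (simp add: power_int_add)
    qed (use real in simp)
    finally show "(\<Sum>i<n. if ennreal (2 powi int_decode i) < y then ennreal (2 powi int_decode i) else 0) \<le> 2 * y"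
      using real by (simp add: ennreal_mult)
  qed
qed simp

lemma dyadic_sum_ge_term:
  assumes "ennreal (2 powi k) < y"
  shows "ennreal (2 powi k) \<le> dyadic_sum y"
proof -
  define t where "t i = (if ennreal (2 powi int_decode i) < y then ennreal (2 powi int_decode i) else 0)" for i
  have "t (int_encode k) \<le> (\<Sum>i. t i)"
    by (rule ennreal_le_suminf)
  then show ?thesis
    using assms by (simp add: t_def dyadic_sum_def)
qed

lemma le_dyadic_sum: "y \<le> 2 * dyadic_sum y"
proof (cases y)
  case (real r)
  show ?thesis
  proof (cases "r = 0")
    case False
    with real have "0 < r" by simp
    \<comment> \<open>The largest exponent with \<open>2 powi k < r\<close>.\<close>
    define k where "k = \<lceil>log 2 r\<rceil> - 1"
    have k: "real_of_int k < log 2 r" "log 2 r \<le> real_of_int (k + 1)"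
      unfolding k_def by linarith+
    have 1: "2 powi k < r" 
      using k(1) \<open>0 < r\<close> by (simp add: less_log_iff powr_real_of_int')
    have 2: "r \<le> 2 powi (k + 1)"
      using k(2) \<open>0 < r\<close> by (subst (asm) log_le_iff) (auto simp: powr_real_of_int' simp del: of_int_add)
    have "y \<le> 2 * ennreal (2 powi k)"
      using 2 real by (simp add: power_int_add mult.commute ennreal_leI flip: ennreal_numeral ennreal_mult)
    also have "\<dots> \<le> 2 * dyadic_sum y"
      using 1 real by (intro mult_left_mono dyadic_sum_ge_term) (auto simp: ennreal_less_iff)
    finally show ?thesis .
  qed (use real in simp)
next
  case top
  have "of_nat n \<le> dyadic_sum y" for n
  proof -
    have "(of_nat n :: ennreal) \<le> ennreal (2 powi int n)"
      using of_nat_less_two_power[of n, where 'a=real] by (simp add: ennreal_of_nat_eq_real_of_nat ennreal_leI less_imp_le)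
    also have "\<dots> \<le> dyadic_sum y"
      by (rule dyadic_sum_ge_term) (simp add: top)
    finally show ?thesis .
  qed
  then have "dyadic_sum y = top"
    by (rule ennreal_eq_top_if_of_nat_le)
  then show ?thesis by simp
qed

text \<open>
  If the superlevel sets of \<open>h\<close> are controlled by those of \<open>g\<close> at the same level, then so are the
  integrals, because both are comparable to sums over levels \<open>2\<^sup>k\<close>. The conclusion speaks of a
  measurable majorant \<open>H\<close> so that it applies to a maximal function, whose superlevel sets are known
  through the open sets that cover them.
\<close>

lemma weak_type_imp_nn_integral_le:
  assumes g [measurable]: "g \<in> borel_measurable M"
    and weak: "\<And>t. 0 < t \<Longrightarrow> \<exists>V\<in>sets M. {x \<in> space M. ennreal t < h x} \<subseteq> V \<and>
      emeasure M V \<le> C * emeasure M {x \<in> space M. ennreal t < g x}"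
  obtains H where "H \<in> borel_measurable M" "\<And>x. x \<in> space M \<Longrightarrow> h x \<le> H x"
    "(\<integral>\<^sup>+x. H x \<partial>M) \<le> 4 * C * (\<integral>\<^sup>+x. g x \<partial>M)"
proof -
  define t :: "nat \<Rightarrow> real" where "t i = 2 powi int_decode i" for i
  have "0 < t i" for i by (simp add: t_def)
  then have "\<forall>i. \<exists>V\<in>sets M. {x \<in> space M. ennreal (t i) < h x} \<subseteq> V \<and>
      emeasure M V \<le> C * emeasure M {x \<in> space M. ennreal (t i) < g x}"
    using weak by blast
  then obtain V where V [measurable]: "\<And>i. V i \<in> sets M"
    and V1: "\<And>i. {x \<in> space M. ennreal (t i) < h x} \<subseteq> V i"
    and V2: "\<And>i. emeasure M (V i) \<le> C * emeasure M {x \<in> space M. ennreal (t i) < g x}"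
    by metis
  define H where "H x = 2 * (\<Sum>i. ennreal (t i) * indicator (V i) x)" for x
  show thesis
  proof
    show "H \<in> borel_measurable M"
      unfolding H_def by measurable
    show "h x \<le> H x" if "x \<in> space M" for x
    proof -
      have "h x \<le> 2 * dyadic_sum (h x)" by (rule le_dyadic_sum)
      also have "dyadic_sum (h x) \<le> (\<Sum>i. ennreal (t i) * indicator (V i) x)"
        unfolding dyadic_sum_def t_def[symmetric]
        using V1 that by (intro suminf_le summableI) (auto split: split_indicator)
      finally show ?thesis by (simp add: H_def mult_left_mono)
    qed
    have "(\<integral>\<^sup>+x. H x \<partial>M) = 2 * (\<Sum>i. ennreal (t i) * emeasure M (V i))"
      unfolding H_def by (simp add: nn_integral_cmult nn_integral_suminf nn_integral_cmult_indicator)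
    also have "\<dots> \<le> 2 * (\<Sum>i. C * (ennreal (t i) * emeasure M {x \<in> space M. ennreal (t i) < g x}))"
      using V2 by (intro mult_left_mono suminf_le summableI) (auto simp: mult.left_commute[of C] intro: mult_left_mono)
    also have "\<dots> = 2 * C * (\<Sum>i. ennreal (t i) * emeasure M {x \<in> space M. ennreal (t i) < g x})"
      by (simp add: mult.assoc)
    also have "(\<Sum>i. ennreal (t i) * emeasure M {x \<in> space M. ennreal (t i) < g x})
        = (\<integral>\<^sup>+x. (\<Sum>i. ennreal (t i) * indicator {x \<in> space M. ennreal (t i) < g x} x) \<partial>M)"
      by (simp add: nn_integral_suminf nn_integral_cmult_indicator)
    also have "\<dots> = (\<integral>\<^sup>+x. dyadic_sum (g x) \<partial>M)"
      unfolding dyadic_sum_def t_def[symmetric]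
      by (intro nn_integral_cong arg_cong[where f = suminf] ext) (auto split: split_indicator)
    also have "\<dots> \<le> (\<integral>\<^sup>+x. 2 * g x \<partial>M)"
      by (intro nn_integral_mono dyadic_sum_le)
    also have "\<dots> = 2 * (\<integral>\<^sup>+x. g x \<partial>M)"
      by (simp add: nn_integral_cmult)
    finally have "(\<integral>\<^sup>+x. H x \<partial>M) \<le> 2 * C * (2 * (\<integral>\<^sup>+x. g x \<partial>M))"
      by (simp add: mult_left_mono)
    also have "\<dots> = (2 * 2) * C * (\<integral>\<^sup>+x. g x \<partial>M)"
      by (simp only: mult_ac)
    finally show "(\<integral>\<^sup>+x. H x \<partial>M) \<le> 4 * C * (\<integral>\<^sup>+x. g x \<partial>M)"
      by simp
  qed
qed

section \<open>Medians\<close>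

lemma fmeasurable_Int_Collect:
  fixes f :: "'a::euclidean_space \<Rightarrow> real"
  assumes f: "f \<in> borel_measurable lebesgue" and "Q \<in> lmeasurable" and P: "Measurable.pred borel P"
  shows "Q \<inter> {x. P (f x)} \<in> lmeasurable"
  using assms(2)
proof (rule fmeasurable_Int_fmeasurable)
  show "{x. P (f x)} \<in> sets lebesgue"
    using measurable_compose[OF f P] by (simp add: pred_def)
qed

text \<open>
  The measure of the superlevel set is right-continuous in \<open>t\<close>, by continuity from below.
\<close>

lemma closed_superlevel_measure_le:
  fixes f :: "'a::euclidean_space \<Rightarrow> real"
  assumes [measurable]: "f \<in> borel_measurable lebesgue" and Q: "Q \<in> lmeasurable"
  shows "closed {t. measure lebesgue (Q \<inter> {x. f x > t}) \<le> c}"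
proof -
  have [measurable]: "Q \<in> sets lebesgue" using Q by auto
  have fm: "Q \<inter> {x. f x > t} \<in> lmeasurable" for t
    by (rule fmeasurable_Int_Collect[OF assms]) measurable
  have "open {t. c < measure lebesgue (Q \<inter> {x. f x > t})}"
  proof (rule openI)
    fix t assume "t \<in> {t. c < measure lebesgue (Q \<inter> {x. f x > t})}"
    then have t: "c < measure lebesgue (Q \<inter> {x. f x > t})" by simp
    define A where "A n = Q \<inter> {x. f x > t + 1 / real (Suc n)}" for n
    have "(\<Union>n. A n) = Q \<inter> {x. f x > t}"
    proof (intro equalityI subsetI)
      fix x assume x: "x \<in> Q \<inter> {x. f x > t}"
      then obtain n where "inverse (real (Suc n)) < f x - t"
        using reals_Archimedean[of "f x - t"] by auto
      with x have "x \<in> A n" by (simp add: A_def field_simps)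
      then show "x \<in> (\<Union>n. A n)" by blast
    qed (auto simp: A_def intro: less_trans[rotated] le_less_trans[rotated])
    moreover have "(\<lambda>n. measure lebesgue (A n)) \<longlonglongrightarrow> measure lebesgue (\<Union>n. A n)"
    proof (rule Lim_measure_incseq)
      show "range A \<subseteq> sets lebesgue" by (auto simp: A_def)
      have "1 / real (Suc n) \<le> 1 / real (Suc m)" if "m \<le> n" for m n
        using that by (intro divide_left_mono) auto
      then show "incseq A"
        unfolding incseq_def A_def by (fastforce intro: le_less_trans)
      show "emeasure lebesgue (\<Union>n. A n) \<noteq> \<infinity>"
        using calculation fm[of t] by (metis emeasure_eq_measure2 ennreal_neq_top infinity_ennreal_def)
    qed
    ultimately obtain n where n: "c < measure lebesgue (A n)"
      using t order_tendstoD(1) eventually_sequentially by (metis (no_types, lifting) order_refl)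
    have "ball t (1 / real (Suc n)) \<subseteq> {t. c < measure lebesgue (Q \<inter> {x. f x > t})}"
    proof
      fix s assume "s \<in> ball t (1 / real (Suc n))"
      then have "s \<le> t + 1 / real (Suc n)"
        by (auto simp: dist_real_def)
      then have "measure lebesgue (A n) \<le> measure lebesgue (Q \<inter> {x. f x > s})"
        by (intro measure_mono_fmeasurable fm) (auto simp: A_def)
      with n show "s \<in> {t. c < measure lebesgue (Q \<inter> {x. f x > t})}" by simp
    qed
    then show "\<exists>\<epsilon>>0. ball t \<epsilon> \<subseteq> {t. c < measure lebesgue (Q \<inter> {x. f x > t})}"
      by (intro exI[of _ "1 / real (Suc n)"]) auto
  qed
  moreover have "{t. measure lebesgue (Q \<inter> {x. f x > t}) \<le> c} = - {t. c < measure lebesgue (Q \<inter> {x. f x > t})}"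
    by auto
  ultimately show ?thesis by (simp add: closed_def)
qed

text \<open>
  Medians are the common points of two closed sets \<open>A\<close> and \<open>B\<close>, given by the two inequalities in their
  definition. The sets cover the line, as a level violating both inequalities would give two disjoint
  subsets of \<open>Q\<close> with more than half its measure each; both are nonempty; so they meet, the line being
  connected. Medians are bounded since \<open>\<bar>f\<bar>\<close> is below some \<open>N\<close> on more than half of \<open>Q\<close>.
\<close>

lemma compact_medians:
  fixes f :: "real ^ 'n \<Rightarrow> real"
  assumes f [measurable]: "f \<in> borel_measurable lebesgue" and Q: "Q \<in> lmeasurable" "0 < measure lebesgue Q"
  shows "compact {\<alpha>. is_median f Q \<alpha>}" "{\<alpha>. is_median f Q \<alpha>} \<noteq> {}"
proof -
  define h where "h = measure lebesgue Q / 2"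
  define A where "A = {t. measure lebesgue (Q \<inter> {x. f x > t}) \<le> h}"
  define B where "B = {t. measure lebesgue (Q \<inter> {x. f x < t}) \<le> h}"
  have [measurable]: "Q \<in> sets lebesgue" using Q by auto
  have fm: "Q \<inter> {x. P (f x)} \<in> lmeasurable" if "Measurable.pred borel P" for P
    by (rule fmeasurable_Int_Collect[OF f Q(1) that])
  have med: "{\<alpha>. is_median f Q \<alpha>} = A \<inter> B"
    by (auto simp: is_median_def A_def B_def h_def)
  have A: "closed A"
    unfolding A_def by (rule closed_superlevel_measure_le) fact+
  have "closed {t. measure lebesgue (Q \<inter> {x. - f x > t}) \<le> h}"
    using Q by (intro closed_superlevel_measure_le) auto
  then have "closed (uminus ` {t. measure lebesgue (Q \<inter> {x. - f x > t}) \<le> h})"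
    by (rule closed_negations)
  moreover have "uminus ` {t. measure lebesgue (Q \<inter> {x. - f x > t}) \<le> h} = B"
  proof -
    have "t \<in> uminus ` {t. measure lebesgue (Q \<inter> {x. - f x > t}) \<le> h} \<longleftrightarrow>
        - t \<in> {t. measure lebesgue (Q \<inter> {x. - f x > t}) \<le> h}" for t
      by (metis (no_types, lifting) add.inverse_inverse image_iff)
    then show ?thesis by (auto simp: B_def)
  qed
  ultimately have B: "closed B" by simp
  have disj: "measure lebesgue (Q \<inter> {x. P (f x)}) + measure lebesgue (Q \<inter> {x. R (f x)}) \<le> 2 * h"
    if "Measurable.pred borel P" "Measurable.pred borel R" "\<And>y. \<not> (P y \<and> R y)" for P R
  proof -
    have "(Q \<inter> {x. P (f x)}) \<inter> (Q \<inter> {x. R (f x)}) = {}"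
      using that(3) by blast
    then have "measure lebesgue (Q \<inter> {x. P (f x)}) + measure lebesgue (Q \<inter> {x. R (f x)})
        = measure lebesgue ((Q \<inter> {x. P (f x)}) \<union> (Q \<inter> {x. R (f x)}))"
      using measure_Un3[OF fm[OF that(1)] fm[OF that(2)]] by simp
    also have "\<dots> \<le> measure lebesgue Q"
      using that Q(1) by (intro measure_mono_fmeasurable) (auto intro!: sets.Un fmeasurableD fm)
    finally show ?thesis by (simp add: h_def)
  qed
  have "A \<union> B = UNIV"
  proof -
    have "t \<in> A \<or> t \<in> B" for t
    proof -
      have "measure lebesgue (Q \<inter> {x. f x > t}) + measure lebesgue (Q \<inter> {x. f x < t}) \<le> 2 * h"
        by (rule disj[of "\<lambda>y. y > t" "\<lambda>y. y < t"]) auto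
      then show ?thesis by (simp add: A_def B_def) linarith
    qed
    then show ?thesis by auto
  qed
  obtain N where N: "h < measure lebesgue (Q \<inter> {x. \<bar>f x\<bar> < real N})"
  proof -
    have "(\<Union>n. Q \<inter> {x. \<bar>f x\<bar> < real n}) = Q"
      by (auto intro: reals_Archimedean2)
    moreover have "(\<lambda>n. measure lebesgue (Q \<inter> {x. \<bar>f x\<bar> < real n})) \<longlonglongrightarrow>
        measure lebesgue (\<Union>n. Q \<inter> {x. \<bar>f x\<bar> < real n})"
    proof (rule Lim_measure_incseq)
      show "range (\<lambda>n. Q \<inter> {x. \<bar>f x\<bar> < real n}) \<subseteq> sets lebesgue"
        by (auto intro!: fmeasurableD fm)
      show "incseq (\<lambda>n. Q \<inter> {x. \<bar>f x\<bar> < real n})"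
        by (auto simp: incseq_def)
      show "emeasure lebesgue (\<Union>n. Q \<inter> {x. \<bar>f x\<bar> < real n}) \<noteq> \<infinity>"
        using calculation Q(1) by (metis emeasure_eq_measure2 ennreal_neq_top infinity_ennreal_def)
    qed
    moreover have "h < measure lebesgue Q" using Q(2) by (simp add: h_def)
    ultimately show thesis
      using that order_tendstoD(1) eventually_sequentially by (metis (no_types, lifting) order_refl)
  qed
  have N1: "t \<in> A \<and> t \<notin> B" if "real N \<le> t" for t
  proof
    show "t \<in> A"
    proof -
      have "measure lebesgue (Q \<inter> {x. \<bar>f x\<bar> < real N}) + measure lebesgue (Q \<inter> {x. f x > t}) \<le> 2 * h"
        using that by (intro disj[of "\<lambda>y. \<bar>y\<bar> < real N" "\<lambda>y. y > t"]) auto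
      then show ?thesis using N by (simp add: A_def)
    qed
    have "measure lebesgue (Q \<inter> {x. \<bar>f x\<bar> < real N}) \<le> measure lebesgue (Q \<inter> {x. f x < t})"
      using that by (intro measure_mono_fmeasurable fmeasurableD fm) auto
    with N show "t \<notin> B" by (simp add: B_def)
  qed
  have N2: "t \<in> B \<and> t \<notin> A" if "t \<le> - real N" for t
  proof
    show "t \<in> B"
    proof -
      have "measure lebesgue (Q \<inter> {x. \<bar>f x\<bar> < real N}) + measure lebesgue (Q \<inter> {x. f x < t}) \<le> 2 * h"
        using that by (intro disj[of "\<lambda>y. \<bar>y\<bar> < real N" "\<lambda>y. y < t"]) auto
      then show ?thesis using N by (simp add: B_def)
    qed
    have "measure lebesgue (Q \<inter> {x. \<bar>f x\<bar> < real N}) \<le> measure lebesgue (Q \<inter> {x. f x > t})"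
      using that by (intro measure_mono_fmeasurable fmeasurableD fm) auto
    with N show "t \<notin> A" by (simp add: A_def)
  qed
  have "A \<inter> B \<subseteq> {- real N .. real N}"
    using N1 N2 by (auto simp: not_le[symmetric]) (meson linear)+
  then show "compact {\<alpha>. is_median f Q \<alpha>}"
    unfolding med using A B by (meson bounded_closed_interval bounded_subset closed_Int compact_eq_bounded_closed)
  show "{\<alpha>. is_median f Q \<alpha>} \<noteq> {}"
    unfolding med using connected_UNIV[where 'a = real] A B \<open>A \<union> B = UNIV\<close> N1[of "real N"] N2[of "- real N"]
    unfolding connected_closed by blast
qed

text \<open>
  The maximum of \<open>\<bar>\<alpha>\<bar>\<close> over the medians is attained, so the choice operator in \<open>max_median\<close> does
  return a median.
\<close>

lemma is_median_max_median:
  fixes f :: "real ^ 'n \<Rightarrow> real"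
  assumes "f \<in> borel_measurable lebesgue" "Q \<in> lmeasurable" "0 < measure lebesgue Q"
  shows "is_median f Q (max_median f Q)"
proof -
  obtain \<alpha> where \<alpha>: "is_median f Q \<alpha>" "\<And>\<beta>. is_median f Q \<beta> \<Longrightarrow> \<bar>\<beta>\<bar> \<le> \<bar>\<alpha>\<bar>"
    using continuous_attains_sup[OF compact_medians[OF assms], of abs] continuous_on_rabs[OF continuous_on_id] by auto
  show ?thesis
    unfolding max_median_def by (rule arg_maxI[of _ \<alpha>]) (use \<alpha> in \<open>auto simp: not_less\<close>)
qed

text \<open>
  If \<open>m\<close> is a median with \<open>t < \<bar>m\<bar>\<close>, then \<open>\<bar>f\<bar>\<close> can be at most \<open>t\<close> only where \<open>f < m\<close> (for \<open>m \<ge> 0\<close>)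
  or where \<open>f > m\<close> (for \<open>m < 0\<close>), which is at most half of \<open>Q\<close>.
\<close>

lemma half_measure_superlevel_max_median:
  fixes f :: "real ^ 'n \<Rightarrow> real"
  assumes f [measurable]: "f \<in> borel_measurable lebesgue" and Q: "Q \<in> lmeasurable" "0 < measure lebesgue Q"
    and t: "t < \<bar>max_median f Q\<bar>"
  shows "measure lebesgue Q / 2 \<le> measure lebesgue (Q \<inter> {x. t < \<bar>f x\<bar>})"
proof -
  have [measurable]: "Q \<in> sets lebesgue" using Q by auto
  define m where "m = max_median f Q"
  have split: "measure lebesgue Q / 2 \<le> measure lebesgue (Q \<inter> {x. t < \<bar>f x\<bar>})"
    if P: "Measurable.pred lebesgue P" "measure lebesgue (Q \<inter> {x. P x}) \<le> measure lebesgue Q / 2"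
      "\<And>x. \<not> P x \<Longrightarrow> t < \<bar>f x\<bar>" for P
  proof -
    have "{x. P x} \<in> sets lebesgue" using P(1) by (simp add: pred_def)
    then have "measure lebesgue Q = measure lebesgue (Q \<inter> {x. P x}) + measure lebesgue (Q - (Q \<inter> {x. P x}))"
      using Q by (subst measurable_measure_Diff) (auto intro: fmeasurable_Int_fmeasurable)
    also have "measure lebesgue (Q - (Q \<inter> {x. P x})) \<le> measure lebesgue (Q \<inter> {x. t < \<bar>f x\<bar>})"
      using P(3) \<open>{x. P x} \<in> sets lebesgue\<close> Q(1)
      by (intro measure_mono_fmeasurable fmeasurable_Int_Collect[OF f Q(1)]) auto
    finally show ?thesis using P(2) by simp
  qed
  have "is_median f Q m"
    unfolding m_def by (rule is_median_max_median) fact+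
  then have m: "measure lebesgue (Q \<inter> {x. f x < m}) \<le> measure lebesgue Q / 2"
    "measure lebesgue (Q \<inter> {x. f x > m}) \<le> measure lebesgue Q / 2"
    by (auto simp: is_median_def)
  show ?thesis
  proof (cases "0 \<le> m")
    case True
    show ?thesis
      by (rule split[of "\<lambda>x. f x < m"], measurable) (use t m True in \<open>auto simp: m_def\<close>)
  next
    case False
    show ?thesis
      by (rule split[of "\<lambda>x. f x > m"], measurable) (use t m False in \<open>auto simp: m_def\<close>)
  qed
qed

lemma max_median_indicator:
  fixes E :: "(real ^ 'n) set"
  assumes E: "E \<in> sets lebesgue" "E \<subseteq> Q" and Q: "Q \<in> lmeasurable" "0 < measure lebesgue Q"
    and half: "measure lebesgue Q / 2 \<le> measure lebesgue E"
  shows "\<bar>max_median (indicator E) Q\<bar> = 1"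
proof -
  have 1: "Q \<inter> {x. indicator E x < (1::real)} = Q - E" "Q \<inter> {x. indicator E x > (1::real)} = {}"
    by (auto simp: indicator_def)
  have "measure lebesgue (Q - E) = measure lebesgue Q - measure lebesgue E"
    using E Q by (intro measurable_measure_Diff) auto
  then have "is_median (indicator E) Q 1"
    using half by (simp add: is_median_def 1)
  moreover have "\<bar>\<beta>\<bar> \<le> \<bar>1\<bar>" if "is_median (indicator E) Q \<beta>" for \<beta>
  proof (rule ccontr)
    assume "\<not> \<bar>\<beta>\<bar> \<le> \<bar>1\<bar>"
    then consider "1 < \<beta>" | "\<beta> < 0" by linarith
    then have "Q \<inter> {x. indicator E x < \<beta>} = Q \<or> Q \<inter> {x. indicator E x > \<beta>} = Q"
      by cases (auto simp: indicator_def)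
    with that Q(2) show False by (auto simp: is_median_def)
  qed
  ultimately have "\<bar>max_median (indicator E) Q\<bar> = \<bar>1\<bar>"
    unfolding max_median_def by (rule arg_max_equality[where f = abs])
  then show ?thesis by simp
qed

section \<open>Local integrability and differentiation\<close>

text \<open>
  The part of the cube where \<open>w \<le> n\<close> has finite weighted measure, and for large \<open>n\<close> it fills more than
  half of the cube.
\<close>

lemma emeasure_weighted_cube_finite:
  fixes w :: "real ^ 'n \<Rightarrow> real"
  assumes w: "weight w" "comparable_on_halves w K" and l: "0 < l"
  shows "emeasure (weighted w) (cube a l) < \<infinity>"
proof -
  have [measurable]: "w \<in> borel_measurable lebesgue" and nn: "\<And>x. 0 \<le> w x"
    using w(1) by (auto simp: weight_def)
  define E where "E n = {x \<in> cube a l. w x \<le> real n}" for n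
  have [measurable]: "E n \<in> sets lebesgue" for n
    unfolding E_def by measurable
  have "(\<Union>n. E n) = cube a l"
    by (auto simp: E_def real_arch_simple)
  moreover have "(\<lambda>n. measure lebesgue (E n)) \<longlonglongrightarrow> measure lebesgue (\<Union>n. E n)"
  proof (rule Lim_measure_incseq)
    show "incseq E" by (auto simp: incseq_def E_def)
    show "emeasure lebesgue (\<Union>n. E n) \<noteq> \<infinity>"
      using calculation l by (simp add: emeasure_cube del: emeasure_completion)
  qed auto
  moreover have "measure lebesgue (cube a l) / 2 < measure lebesgue (cube a l)"
    using l by (simp add: measure_cube)
  ultimately obtain n where n: "measure lebesgue (cube a l) / 2 < measure lebesgue (E n)"
    using order_tendstoD(1) eventually_sequentially by (metis (no_types, lifting) order_refl)
  have "emeasure (weighted w) (E n) \<le> (\<integral>\<^sup>+x. ennreal (real n) * indicator (cube a l) x \<partial>lebesgue)"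
    unfolding emeasure_density[OF measurable_compose[OF \<open>w \<in> borel_measurable lebesgue\<close> measurable_ennreal] \<open>E n \<in> sets lebesgue\<close>]
    by (intro nn_integral_mono) (auto simp: E_def ennreal_leI split: split_indicator)
  also have "\<dots> < \<infinity>"
    using l by (simp add: nn_integral_cmult_indicator emeasure_cube ennreal_mult_less_top del: emeasure_completion)
  finally have "emeasure (weighted w) (E n) < \<infinity>" .
  moreover have "emeasure (weighted w) (cube a l) \<le> ennreal K * emeasure (weighted w) (E n)"
    using n l by (intro comparable_on_halvesD[OF w(2)]) (auto simp: cube_in_cubes E_def)
  ultimately show ?thesis
    by (metis ennreal_less_top ennreal_mult_less_top infinity_ennreal_def order_le_less_trans)
qed

lemma cube_measurable_weighted:
  fixes w :: "real ^ 'n \<Rightarrow> real"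
  assumes "weight w" "comparable_on_halves w K" "0 < l"
  shows "cube a l \<in> fmeasurable (weighted w)"
  using emeasure_weighted_cube_finite[OF assms] by (simp add: fmeasurable_def)

lemma measure_weighted_doubling:
  fixes w :: "real ^ 'n \<Rightarrow> real"
  assumes w: "weight w" "comparable_on_halves w K" and l: "0 < l" "cube a l \<subseteq> cube A (2 * l)"
  shows "measure (weighted w) (cube A (2 * l)) \<le> K ^ CARD('n) * measure (weighted w) (cube a l)"
proof -
  have K: "0 \<le> K" using w(2) by (simp add: comparable_on_halves_def)
  have "emeasure (weighted w) (cube A (2 * l)) \<le> ennreal (K ^ (1 * CARD('n))) * emeasure (weighted w) (cube a l)"
    using l by (intro weighted_cube_doubling[OF w(2)]) auto
  then show ?thesis
    using cube_measurable_weighted[OF w, of l a] cube_measurable_weighted[OF w, of "2 * l" A] l K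
    by (simp add: emeasure_eq_measure2 flip: ennreal_mult)
qed

lemma vec_One_nth: "(\<Sum>Basis :: real ^ 'n) $ i = 1"
proof -
  have "(\<Sum>Basis :: real ^ 'n) $ i = (\<Sum>Basis :: real ^ 'n) \<bullet> axis i 1"
    by (simp add: inner_axis)
  also have "\<dots> = 1"
    using inner_sum_left_Basis[of "axis i 1 :: real ^ 'n" "\<lambda>_. 1"] by (simp add: axis_in_Basis_iff)
  finally show ?thesis .
qed

lemma has_integral_measure_weighted:
  fixes w :: "real ^ 'n \<Rightarrow> real"
  assumes "weight w" and S: "S \<in> fmeasurable (weighted w)"
  shows "(w has_integral measure (weighted w) S) S"
proof -
  have w [measurable]: "w \<in> borel_measurable lebesgue" and nn: "\<And>x. 0 \<le> w x"
    using assms by (auto simp: weight_def)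
  have [measurable]: "S \<in> sets lebesgue" using fmeasurableD[OF S] by simp
  have "((\<lambda>x. if x \<in> S then w x else 0) has_integral measure (weighted w) S) UNIV"
  proof (rule has_integral_iff_nn_integral_lebesgue[THEN iffD2], goal_cases)
    case 1
    then show ?case using nn by simp
  next
    case 2
    show ?case
    proof (intro conjI)
    show "(\<lambda>x. if x \<in> S then w x else 0) \<in> borel_measurable lebesgue"
      by measurable
    have "(\<integral>\<^sup>+x. ennreal (if x \<in> S then w x else 0) \<partial>lebesgue) = (\<integral>\<^sup>+x. ennreal (w x) * indicator S x \<partial>lebesgue)"
      by (intro nn_integral_cong) auto
    also have "\<dots> = emeasure (weighted w) S"
      by (subst emeasure_density) auto
    also have "\<dots> = ennreal (measure (weighted w) S)"
      using S by (rule emeasure_eq_measure2)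
    finally show "(\<integral>\<^sup>+x. ennreal (if x \<in> S then w x else 0) \<partial>lebesgue) = ennreal (measure (weighted w) S)" .
    qed simp
  qed
  then show ?thesis
    by (simp add: has_integral_restrict_UNIV)
qed

text \<open>
  Lebesgue's differentiation theorem, for cubes that have the point as their lower corner.
\<close>

lemma AE_cube_average_tendsto:
  fixes w :: "real ^ 'n \<Rightarrow> real"
  assumes w: "weight w" and fin: "\<And>a l. 0 < l \<Longrightarrow> cube a l \<in> fmeasurable (weighted w)"
  shows "AE x in lebesgue. \<forall>e>0. \<exists>d>0. \<forall>h. 0 < h \<and> h < d \<longrightarrow>
    \<bar>measure (weighted w) (cube x h) / h ^ CARD('n) - w x\<bar> < e"
proof -
  have "w integrable_on cbox a b" for a b :: "real ^ 'n"
  proof -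
    define l where "l = Max (range (\<lambda>i. \<bar>b $ i - a $ i\<bar>)) + 1"
    have l: "\<bar>b $ i - a $ i\<bar> + 1 \<le> l" for i
      by (simp add: l_def)
    then have "cbox a b \<subseteq> cube a l"
      by (auto simp: mem_cube mem_box_cart) (smt (verit))
    moreover have "0 < l" using l[of undefined] by linarith
    then have "w integrable_on cube a l"
      using has_integral_measure_weighted[OF w fin] by blast
    ultimately show ?thesis
      using integrable_on_subcbox by (auto simp: cube_def)
  qed
  then obtain N where N: "negligible N" "\<And>x e. \<lbrakk>x \<notin> N; 0 < e\<rbrakk> \<Longrightarrow> \<exists>d>0. \<forall>h. 0 < h \<and> h < d \<longrightarrow>
      norm (integral (cbox x (x + h *\<^sub>R \<Sum>Basis)) w /\<^sub>R h ^ DIM(real ^ 'n) - w x) < e"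
    using integrable_ccontinuous_explicit[of w] by metis
  have eq: "integral (cbox x (x + h *\<^sub>R \<Sum>Basis)) w /\<^sub>R h ^ DIM(real ^ 'n)
      = measure (weighted w) (cube x h) / h ^ CARD('n)" if "0 < h" for x h
  proof -
    \<comment> \<open>The sum of the basis vectors is the vector with all coordinates one.\<close>
    have "cbox x (x + h *\<^sub>R \<Sum>Basis) = cube x h"
      unfolding cube_def
      by (rule arg_cong[where f = "cbox x"]) (simp add: vec_eq_iff vec_One_nth del: sum_component)
    then show ?thesis
      using has_integral_measure_weighted[OF w fin[OF that]] by (simp add: integral_unique divide_inverse mult.commute)
  qed
  have "AE x in lebesgue. x \<notin> N"
    using N(1) by (simp add: negligible_iff_null_sets AE_not_in)
  then show ?thesis
  proof (rule AE_mp, intro AE_I2 impI allI)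
    fix x and e :: real assume "x \<notin> N" "0 < e"
    then show "\<exists>d>0. \<forall>h. 0 < h \<and> h < d \<longrightarrow> \<bar>measure (weighted w) (cube x h) / h ^ CARD('n) - w x\<bar> < e"
      using N(2) by (metis (no_types, lifting) eq real_norm_def)
  qed
qed

section \<open>Dyadic subcubes\<close>

text \<open>
  The half-open dyadic subcubes of generation \<open>k\<close> of \<open>cube a l\<close> are the fibres of a map to integer
  vectors. The map is defined everywhere, so it partitions the whole space; the subcubes of
  \<open>cube a l\<close> are those with index \<open>0\<close> in generation \<open>0\<close>. The cells give disjointness, and
  their closures are cubes.
\<close>

definition dyadic_index :: "real ^ 'n \<Rightarrow> real \<Rightarrow> nat \<Rightarrow> real ^ 'n \<Rightarrow> int ^ 'n" where
  "dyadic_index a l k x = (\<chi> i. \<lfloor>2 ^ k * ((x $ i - a $ i) / l)\<rfloor>)"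

definition dyadic_cell :: "real ^ 'n \<Rightarrow> real \<Rightarrow> nat \<Rightarrow> int ^ 'n \<Rightarrow> (real ^ 'n) set" where
  "dyadic_cell a l k m = {x. dyadic_index a l k x = m}"

definition dyadic_corner :: "real ^ 'n \<Rightarrow> real \<Rightarrow> nat \<Rightarrow> int ^ 'n \<Rightarrow> real ^ 'n" where
  "dyadic_corner a l k m = (\<chi> i. a $ i + l / 2 ^ k * of_int (m $ i))"

lemma mem_dyadic_cell:
  assumes "0 < l"
  shows "x \<in> dyadic_cell a l k m \<longleftrightarrow>
    (\<forall>i. dyadic_corner a l k m $ i \<le> x $ i \<and> x $ i < dyadic_corner a l k m $ i + l / 2 ^ k)"
proof -
  have "\<lfloor>2 ^ k * ((x $ i - a $ i) / l)\<rfloor> = m $ i \<longleftrightarrow>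
      dyadic_corner a l k m $ i \<le> x $ i \<and> x $ i < dyadic_corner a l k m $ i + l / 2 ^ k" for i
    using assms by (simp add: floor_eq_iff dyadic_corner_def field_simps)
  then show ?thesis
    by (simp add: dyadic_cell_def dyadic_index_def vec_eq_iff)
qed

lemma dyadic_cell_subset:
  "0 < l \<Longrightarrow> dyadic_cell a l k m \<subseteq> cube (dyadic_corner a l k m) (l / 2 ^ k)"
  by (auto simp: mem_dyadic_cell mem_cube less_imp_le)

lemma dyadic_index_parent:
  "dyadic_index a l k x = (\<chi> i. dyadic_index a l (Suc k) x $ i div 2)"
proof -
  have "\<lfloor>2 ^ k * ((x $ i - a $ i) / l)\<rfloor> = \<lfloor>2 ^ Suc k * ((x $ i - a $ i) / l)\<rfloor> div 2" for i
    using floor_divide_real_eq_div[of 2 "2 ^ Suc k * ((x $ i - a $ i) / l)"] by simp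
  then show ?thesis by (simp add: dyadic_index_def vec_eq_iff)
qed

lemma dyadic_index_coarser:
  assumes "dyadic_index a l k x = dyadic_index a l k y" "j \<le> k"
  shows "dyadic_index a l j x = dyadic_index a l j y"
  using assms(2,1)
proof (induction k rule: dec_induct)
  case (step k)
  then show ?case by (metis dyadic_index_parent)
qed

lemma dyadic_parent_cube:
  assumes "0 < l"
  shows "cube (dyadic_corner a l (Suc k) m) (l / 2 ^ Suc k) \<subseteq> cube (dyadic_corner a l k (\<chi> i. m $ i div 2)) (2 * (l / 2 ^ Suc k))"
proof -
  have "2 * (m $ i div 2) \<le> m $ i \<and> m $ i + 1 \<le> 2 * (m $ i div 2) + 2" for i
    by presburger
  then have "2 * real_of_int (m $ i div 2) \<le> m $ i \<and> real_of_int (m $ i) + 1 \<le> 2 * real_of_int (m $ i div 2) + 2" for i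
    by (smt (verit) of_int_1 of_int_add of_int_le_iff of_int_mult of_int_numeral)
  then have "l / 2 ^ Suc k * (2 * real_of_int (m $ i div 2)) \<le> l / 2 ^ Suc k * m $ i
      \<and> l / 2 ^ Suc k * (real_of_int (m $ i) + 1) \<le> l / 2 ^ Suc k * (2 * real_of_int (m $ i div 2) + 2)" for i
    using assms by (intro conjI mult_left_mono) auto
  moreover have "dyadic_corner a l (Suc k) m $ i = a $ i + l / 2 ^ Suc k * m $ i"
    "dyadic_corner a l k (\<chi> i. m $ i div 2) $ i = a $ i + l / 2 ^ Suc k * (2 * real_of_int (m $ i div 2))" for i
    by (simp_all add: dyadic_corner_def)
  ultimately show ?thesis
    using assms by (simp add: cube_subset_iff distrib_left)
qed

lemma negligible_cube_frontier: "negligible (cube a l - box a (\<chi> i. a $ i + l))"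
  using negligible_frontier_interval(1)[of a "\<chi> i. a $ i + l"] by (simp add: cube_def)

lemma AE_dyadic_cell:
  assumes "0 < l"
  shows "AE x in lebesgue. x \<in> dyadic_cell a l k m \<longleftrightarrow> x \<in> cube (dyadic_corner a l k m) (l / 2 ^ k)"
proof -
  let ?c = "dyadic_corner a l k m"
  have "AE x in lebesgue. x \<notin> cube ?c (l / 2 ^ k) - box ?c (\<chi> i. ?c $ i + l / 2 ^ k)"
    using negligible_cube_frontier[of ?c "l / 2 ^ k"] unfolding negligible_iff_null_sets by (rule AE_not_in)
  then show ?thesis
  proof (rule eventually_mono)
    fix x
    assume x: "x \<notin> cube ?c (l / 2 ^ k) - box ?c (\<chi> i. ?c $ i + l / 2 ^ k)"
    then show "x \<in> dyadic_cell a l k m \<longleftrightarrow> x \<in> cube ?c (l / 2 ^ k)"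
      using dyadic_cell_subset[OF assms, of a k m]
    by (auto simp: mem_dyadic_cell[OF assms] mem_box_cart less_imp_le)
  qed
qed

lemma dyadic_cell_sets [measurable]: "dyadic_cell a l k m \<in> sets lebesgue"
proof -
  have "dyadic_cell a l k m = {x. \<forall>i. \<lfloor>2 ^ k * ((x $ i - a $ i) / l)\<rfloor> = m $ i}"
    by (simp add: dyadic_cell_def dyadic_index_def vec_eq_iff)
  also have "\<dots> \<in> sets borel"
    by measurable
  finally show ?thesis by simp
qed

lemma emeasure_dyadic_cell:
  fixes a :: "real ^ 'n"
  assumes "0 < l" and w: "w \<in> borel_measurable lebesgue"
  shows "emeasure lebesgue (dyadic_cell a l k m) = ennreal ((l / 2 ^ k) ^ CARD('n))"
    and "emeasure (weighted w) (dyadic_cell a l k m) = emeasure (weighted w) (cube (dyadic_corner a l k m) (l / 2 ^ k))"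
proof -
  show "emeasure lebesgue (dyadic_cell a l k m) = ennreal ((l / 2 ^ k) ^ CARD('n))"
    using emeasure_eq_AE[OF AE_dyadic_cell[OF assms(1)]] assms(1)
    by (simp add: emeasure_cube del: emeasure_completion)
  have "AE x in weighted w. x \<in> dyadic_cell a l k m \<longleftrightarrow> x \<in> cube (dyadic_corner a l k m) (l / 2 ^ k)"
    
    unfolding AE_density[OF measurable_compose[OF w measurable_ennreal]]
    using AE_dyadic_cell[OF assms(1), of a k m] by (rule eventually_mono) simp
  then show "emeasure (weighted w) (dyadic_cell a l k m) = emeasure (weighted w) (cube (dyadic_corner a l k m) (l / 2 ^ k))"
    by (rule emeasure_eq_AE) auto
qed

section \<open>Decay of sublevel sets\<close>

definition cube_mean :: "(real ^ 'n \<Rightarrow> real) \<Rightarrow> real ^ 'n \<Rightarrow> real \<Rightarrow> real" where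
  "cube_mean w a l = measure (weighted w) (cube a l) / l ^ CARD('n)"

text \<open>
  At almost every point \<open>x\<close> the means over the dyadic cubes around \<open>x\<close> eventually exceed \<open>w x\<close> by at most
  a factor close to \<open>K ^ n\<close>. Indeed, a dyadic cube of side \<open>h\<close> containing \<open>x\<close> and the cube of side \<open>h\<close> with
  lower corner \<open>x\<close> lie in a common cube of side \<open>2 * h\<close>; so doubling compares the two, and the mean over
  the latter tends to \<open>w x\<close>. The loss of a constant factor is harmless below.
\<close>

lemma AE_dyadic_cube_mean_less:
  fixes w :: "real ^ 'n \<Rightarrow> real" and a :: "real ^ 'n"
  assumes w: "weight w" "comparable_on_halves w K" and l: "0 < l"
  shows "AE x in lebesgue. \<forall>t > w x. \<exists>j.
    cube_mean w (dyadic_corner a l j (dyadic_index a l j x)) (l / 2 ^ j) < K ^ CARD('n) * t"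
proof (rule eventually_mono[OF AE_cube_average_tendsto[OF w(1) cube_measurable_weighted[OF w]]], assumption, intro allI impI)
  fix x t
  assume lim: "\<forall>e>0. \<exists>d>0. \<forall>h. 0 < h \<and> h < d \<longrightarrow> \<bar>measure (weighted w) (cube x h) / h ^ CARD('n) - w x\<bar> < e"
    and t: "w x < t"
  have "0 < t - w x" using t by simp
  with lim obtain \<delta> where \<delta>: "0 < \<delta>"
    "\<And>h. 0 < h \<and> h < \<delta> \<Longrightarrow> \<bar>measure (weighted w) (cube x h) / h ^ CARD('n) - w x\<bar> < t - w x"
    by blast
  obtain j where j: "(1 / 2) ^ j < \<delta> / l"
    using real_arch_pow_inv[of "\<delta> / l" "1 / 2"] \<delta>(1) l by auto
  define h where "h = l / 2 ^ j"
  have h: "0 < h" "h < \<delta>"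
    using j l by (auto simp: h_def field_simps power_one_over)
  define c where "c = dyadic_corner a l j (dyadic_index a l j x)"
  have x: "c $ i \<le> x $ i \<and> x $ i < c $ i + h" for i
    using mem_dyadic_cell[OF l, of x a j "dyadic_index a l j x"] by (simp add: c_def h_def dyadic_cell_def)
  have sub: "cube x h \<subseteq> cube c (2 * h)" "cube c h \<subseteq> cube c (2 * h)"
    using x h(1) by (auto simp: cube_subset_iff less_imp_le) (smt (verit))
  have "measure (weighted w) (cube c h) \<le> measure (weighted w) (cube c (2 * h))"
    using sub(2) h by (intro measure_mono_fmeasurable cube_measurable_weighted[OF w]) auto
  also have "\<dots> \<le> K ^ CARD('n) * measure (weighted w) (cube x h)"
    by (rule measure_weighted_doubling[OF w h(1) sub(1)])
  also have "\<dots> < K ^ CARD('n) * (t * h ^ CARD('n))"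
  proof (rule mult_strict_left_mono)
    have "measure (weighted w) (cube x h) / h ^ CARD('n) < t"
      using \<delta>(2)[of h] h by linarith
    then show "measure (weighted w) (cube x h) < t * h ^ CARD('n)"
      using h by (simp add: field_simps)
    show "0 < K ^ CARD('n)"
      using w(2) by (simp add: comparable_on_halves_def)
  qed
  finally have "cube_mean w c h < K ^ CARD('n) * t"
    using h by (simp add: cube_mean_def field_simps)
  then show "\<exists>j. cube_mean w (dyadic_corner a l j (dyadic_index a l j x)) (l / 2 ^ j) < K ^ CARD('n) * t"
    unfolding c_def h_def by blast
qed

text \<open>
  By induction on \<open>k\<close> over all cubes at once; each step gains a factor \<open>1 / 2\<close>. In a cube \<open>Q\<close> with mean \<open>A\<close>, stop at the maximal dyadic
  subcubes on which the mean drops below \<open>b * A\<close>, where \<open>K * b = 1 / 2\<close>.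

  Their union \<open>E\<close> has weighted measure at most \<open>b * A * \<bar>Q\<bar>\<close>, which is half of \<open>1 / K\<close> times that of
  \<open>Q\<close>. So \<open>E\<close> fills at most half of \<open>Q\<close>. On the other hand, the parent of a stopping cube has mean at
  least \<open>b * A\<close>, so by doubling the mean on the stopping cube is still at least \<open>d * A\<close>, where
  \<open>d = b / K ^ n\<close>. Hence in a stopping cube the set where \<open>w < d ^ Suc k * A\<close> lies in a sublevel set of
  the kind covered by the induction hypothesis. Finally, almost every point with \<open>w x < d * A\<close> lies in
  \<open>E\<close>, by \<open>AE_dyadic_cube_mean_less\<close>.
\<close>

lemma emeasure_sublevel_decay:
  fixes w :: "real ^ 'n \<Rightarrow> real"
  assumes w: "weight w" "comparable_on_halves w K" and "0 < l"
  shows "emeasure lebesgue {x \<in> cube a l. w x < (1 / (2 * K ^ Suc CARD('n))) ^ k * cube_mean w a l}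
    \<le> ennreal ((1 / 2) ^ k * l ^ CARD('n))"
  using \<open>0 < l\<close>
proof (induction k arbitrary: a l)
  case 0
  then have "emeasure lebesgue {x \<in> cube a l. w x < (1 / (2 * K ^ Suc CARD('n))) ^ 0 * cube_mean w a l}
      \<le> emeasure lebesgue (cube a l)"
    by (intro emeasure_mono) auto
  with 0 show ?case by (simp add: emeasure_cube del: emeasure_completion)
next
  case (Suc k)
  note l = \<open>0 < l\<close>
  have w_meas [measurable]: "w \<in> borel_measurable lebesgue" and nn: "\<And>x. 0 \<le> w x"
    using w(1) by (auto simp: weight_def)
  have K: "1 \<le> K" using w(2) by (simp add: comparable_on_halves_def)
  define n where "n = CARD('n)"
  \<comment> \<open>The threshold, relative to the mean on the whole cube, at which to stop.\<close>
  define b where "b = 1 / (2 * K)"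
  define d where "d = 1 / (2 * K ^ Suc n)"
  have "1 \<le> K ^ Suc n" using K by (rule one_le_power)
  then have d: "0 < d" "d \<le> 1" "K ^ n * d = b"
    using K by (auto simp: d_def b_def)
  have b: "0 < b" "b \<le> 1" "K * b = 1 / 2"
    using K by (auto simp: b_def)
  define A where "A = cube_mean w a l"
  define X where "X = {x. w x < d ^ Suc k * A}"
  have "X = w -` {..<d ^ Suc k * A} \<inter> space lebesgue"
    by (auto simp: X_def)
  then have [measurable]: "X \<in> sets lebesgue"
    by (simp only:) (rule measurable_sets[OF w_meas], simp)
  have goal_eq: "{x \<in> cube a l. w x < (1 / (2 * K ^ Suc CARD('n))) ^ Suc k * cube_mean w a l} = cube a l \<inter> X"
    by (auto simp: X_def A_def d_def n_def)
  have "0 \<le> A"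
    using l by (simp add: A_def cube_mean_def)
  show ?case
  proof (cases "A = 0")
    case True
    then have "X = {}" using nn by (auto simp: X_def not_less)
    then show ?thesis unfolding goal_eq by simp
  next
    case False
    with \<open>0 \<le> A\<close> have "0 < A" by simp
    define side where "side j = l / 2 ^ j" for j :: nat
    have side: "0 < side j" for j using l by (simp add: side_def)
    define stop where "stop j m \<longleftrightarrow> cube_mean w (dyadic_corner a l j m) (side j) < b * A" for j m
    have corner0: "dyadic_corner a l 0 0 = a"
      by (simp add: dyadic_corner_def vec_eq_iff)
    have not_stop0: "\<not> stop 0 0"
      using b \<open>0 < A\<close> by (simp add: stop_def side_def corner0 A_def[symmetric])
    \<comment> \<open>First stopping times: generation and index of the maximal cubes with small mean.\<close>
    define J where "J = {(j, dyadic_index a l j x) |j x. dyadic_index a l 0 x = 0 \<and>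
      stop j (dyadic_index a l j x) \<and> (\<forall>i<j. \<not> stop i (dyadic_index a l i x))}"
    define cell where "cell p = dyadic_cell a l (fst p) (snd p)" for p
    define E where "E = (\<Union>p\<in>J. cell p)"
    have [measurable]: "cell p \<in> sets lebesgue" for p by (simp add: cell_def)
    have J: "dyadic_index a l 0 y = 0" "snd p = dyadic_index a l (fst p) y"
      "\<And>i. i < fst p \<Longrightarrow> \<not> stop i (dyadic_index a l i y)" "stop (fst p) (dyadic_index a l (fst p) y)"
      if "p \<in> J" "y \<in> cell p" for p y
    proof -
      obtain j x where x: "p = (j, dyadic_index a l j x)" "dyadic_index a l 0 x = 0"
        "stop j (dyadic_index a l j x)" "\<And>i. i < j \<Longrightarrow> \<not> stop i (dyadic_index a l i x)"
        using \<open>p \<in> J\<close> by (auto simp: J_def)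
      have eq: "dyadic_index a l j y = dyadic_index a l j x"
        using \<open>y \<in> cell p\<close> x(1) by (simp add: cell_def dyadic_cell_def)
      then have "dyadic_index a l i y = dyadic_index a l i x" if "i \<le> j" for i
        using dyadic_index_coarser that by blast
      then show "dyadic_index a l 0 y = 0" "snd p = dyadic_index a l (fst p) y"
        "\<And>i. i < fst p \<Longrightarrow> \<not> stop i (dyadic_index a l i y)" "stop (fst p) (dyadic_index a l (fst p) y)"
        using x by auto
    qed
    \<comment> \<open>The generation of a cell in the family is the first stopping time of each of its points.\<close>
    have disj: "disjoint_family_on cell J"
      unfolding disjoint_family_on_def
    proof (intro ballI impI)
      fix p q assume pq: "p \<in> J" "q \<in> J" "p \<noteq> q"
      show "cell p \<inter> cell q = {}"
      proof (rule ccontr)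
        assume "cell p \<inter> cell q \<noteq> {}"
        then obtain y where y: "y \<in> cell p" "y \<in> cell q" by auto
        have "fst p = fst q"
          using J(3,4)[OF pq(1) y(1)] J(3,4)[OF pq(2) y(2)] by (meson linorder_neqE_nat)
        then have "p = q"
          using J(2)[OF pq(1) y(1)] J(2)[OF pq(2) y(2)] by (simp add: prod_eq_iff)
        with pq(3) show False by simp
      qed
    qed
    have "E \<subseteq> cube a l"
      using J(1) dyadic_cell_subset[OF l, of a 0 0] by (auto simp: E_def dyadic_cell_def corner0)
    have [measurable]: "E \<in> sets lebesgue"
      unfolding E_def by (intro sets.countable_UN') auto
    have "emeasure (weighted w) E \<le> ennreal (b * A) * emeasure lebesgue E"
      unfolding E_def
    proof (rule emeasure_disjoint_UN_le[OF _ _ _ disj disj])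
      fix p assume "p \<in> J"
      then obtain y where "y \<in> cell p"
        by (auto simp: J_def cell_def dyadic_cell_def)
      then have "stop (fst p) (snd p)"
        using J(2,4)[OF \<open>p \<in> J\<close>] by simp
      then have "measure (weighted w) (cube (dyadic_corner a l (fst p) (snd p)) (side (fst p)))
          \<le> b * A * side (fst p) ^ n"
        using side[of "fst p"] by (simp add: stop_def cube_mean_def n_def field_simps)
      then show "emeasure (weighted w) (cell p) \<le> ennreal (b * A) * emeasure lebesgue (cell p)"
        using emeasure_dyadic_cell[OF l w_meas, of a "fst p" "snd p"] b(1) \<open>0 < A\<close> side[of "fst p"]
          emeasure_eq_measure2[OF cube_measurable_weighted[OF w side]]
        by (simp add: cell_def side_def[symmetric] n_def ennreal_leI del: emeasure_completion flip: ennreal_mult)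
    qed auto
    have mcube: "emeasure (weighted w) (cube a l) = ennreal (A * l ^ n)"
      using l by (simp add: emeasure_eq_measure2[OF cube_measurable_weighted[OF w l]] A_def cube_mean_def n_def)
    have "measure lebesgue E \<le> l ^ n / 2"
    proof (rule ccontr)
      assume "\<not> measure lebesgue E \<le> l ^ n / 2"
      then have "emeasure (weighted w) (cube a l) \<le> ennreal K * emeasure (weighted w) E"
        using l \<open>E \<subseteq> cube a l\<close>
        by (intro comparable_on_halvesD[OF w(2)]) (auto simp: cube_in_cubes measure_cube n_def)
      also have "\<dots> \<le> ennreal K * (ennreal (b * A) * emeasure lebesgue E)"
        by (intro mult_left_mono) (fact, simp)
      also have "\<dots> \<le> ennreal K * (ennreal (b * A) * emeasure lebesgue (cube a l))"
        using \<open>E \<subseteq> cube a l\<close> by (intro mult_left_mono emeasure_mono) auto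
      also have "\<dots> = ennreal (K * b * (A * l ^ n))"
        using K b(1) \<open>0 < A\<close> l
        by (simp add: emeasure_cube n_def mult.assoc del: emeasure_completion flip: ennreal_mult)
      also have "\<dots> = ennreal (A * l ^ n / 2)"
        by (simp add: b(3))
      finally have "A * l ^ n \<le> A * l ^ n / 2"
        unfolding mcube using \<open>0 < A\<close> l by (subst (asm) ennreal_le_iff) auto
      then show False using \<open>0 < A\<close> l by simp
    qed
    moreover have "E \<in> lmeasurable"
      by (rule fmeasurableI2[OF cube_lmeasurable \<open>E \<subseteq> cube a l\<close>]) measurable
    ultimately have E_half: "emeasure lebesgue E \<le> ennreal (l ^ n / 2)"
      by (simp add: emeasure_eq_measure2 ennreal_leI)
    have cell_bound: "emeasure lebesgue (cell p \<inter> X) \<le> ennreal ((1 / 2) ^ k) * emeasure lebesgue (cell p)" if p: "p \<in> J" for p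
    proof -
      obtain x where x: "x \<in> cell p"
        using p by (auto simp: J_def cell_def dyadic_cell_def)
      have "fst p \<noteq> 0"
      proof
        assume "fst p = 0"
        with J(1)[OF p x] J(4)[OF p x] not_stop0 show False by simp
      qed
      then obtain j where j: "fst p = Suc j" by (cases "fst p") auto
      define m where "m = snd p"
      define c where "c = dyadic_corner a l (Suc j) m"
      define C where "C = dyadic_corner a l j (\<chi> i. m $ i div 2)"
      define s where "s = side (Suc j)"
      have s: "0 < s" "side j = 2 * s" using side[of "Suc j"] by (simp_all add: s_def side_def)
      \<comment> \<open>The parent has not been stopped, which bounds the mean on the cell from below.\<close>
      have "\<not> stop j (dyadic_index a l j x)"
        using J(3)[OF p x, of j] j by simp
      moreover have "dyadic_index a l j x = (\<chi> i. m $ i div 2)"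
        using J(2)[OF p x] dyadic_index_parent[of a l j x] by (simp add: m_def j)
      ultimately have "b * A \<le> cube_mean w C (2 * s)"
        by (simp add: stop_def C_def s not_less)
      then have "b * A * (2 * s) ^ n \<le> measure (weighted w) (cube C (2 * s))"
        using s by (simp add: cube_mean_def n_def field_simps)
      also have "\<dots> \<le> K ^ n * measure (weighted w) (cube c s)"
        unfolding n_def using dyadic_parent_cube[OF l, of a j m] s(1)
        by (intro measure_weighted_doubling[OF w]) (auto simp: c_def C_def s_def side_def)
      finally have *: "b * A * (2 * s) ^ n \<le> K ^ n * measure (weighted w) (cube c s)" .
      have "s ^ n \<le> (2 * s) ^ n"
        using s by (intro power_mono) auto
      then have "b * A * s ^ n \<le> b * A * (2 * s) ^ n"
        using b(1) \<open>0 < A\<close> by (intro mult_left_mono) auto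
      moreover have "K ^ n * (d * A * s ^ n) = b * A * s ^ n"
        unfolding d(3)[symmetric] by (simp only: mult_ac)
      ultimately have "K ^ n * (d * A * s ^ n) \<le> b * A * (2 * s) ^ n"
        by (simp only:)
      with * have "K ^ n * (d * A * s ^ n) \<le> K ^ n * measure (weighted w) (cube c s)"
        by linarith
      then have "d * A * s ^ n \<le> measure (weighted w) (cube c s)"
        using K by (subst (asm) mult_le_cancel_left_pos) auto
      then have "d * A \<le> cube_mean w c s"
        using s by (simp add: cube_mean_def n_def field_simps)
      then have "d ^ Suc k * A \<le> d ^ k * cube_mean w c s"
        using d(1) by (simp add: mult.assoc mult.left_commute[of d] mult_left_mono)
      then have "cell p \<inter> X \<subseteq> {x \<in> cube c s. w x < d ^ k * cube_mean w c s}"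
        using dyadic_cell_subset[OF l, of a "Suc j" m] unfolding cell_def j m_def[symmetric] c_def s_def side_def X_def
        by force
      then have "emeasure lebesgue (cell p \<inter> X) \<le> emeasure lebesgue {x \<in> cube c s. w x < d ^ k * cube_mean w c s}"
        by (intro emeasure_mono) measurable
      also have "\<dots> \<le> ennreal ((1 / 2) ^ k * s ^ CARD('n))"
        using Suc.IH[OF s(1), of c] by (simp add: d_def n_def)
      also have "\<dots> = ennreal ((1 / 2) ^ k) * ennreal (s ^ CARD('n))"
        using s(1) by (intro ennreal_mult) auto
      also have "ennreal (s ^ CARD('n)) = emeasure lebesgue (cell p)"
        using emeasure_dyadic_cell(1)[OF l w_meas, of a "Suc j" m] by (simp add: cell_def j m_def s_def side_def)
      finally show ?thesis .
    qed
    have "AE x in lebesgue. x \<in> cube a l \<inter> X \<longrightarrow> x \<in> (\<Union>p\<in>J. cell p \<inter> X)"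
      using AE_dyadic_cube_mean_less[OF w l, of a] AE_dyadic_cell[OF l, of a 0 0]
    proof eventually_elim
      fix x
      assume lim: "\<forall>t > w x. \<exists>j. cube_mean w (dyadic_corner a l j (dyadic_index a l j x)) (l / 2 ^ j) < K ^ CARD('n) * t"
        and cell0: "x \<in> dyadic_cell a l 0 0 \<longleftrightarrow> x \<in> cube (dyadic_corner a l 0 0) (l / 2 ^ 0)"
      show "x \<in> cube a l \<inter> X \<longrightarrow> x \<in> (\<Union>p\<in>J. cell p \<inter> X)"
      proof
        assume x: "x \<in> cube a l \<inter> X"
        have 0: "dyadic_index a l 0 x = 0"
          using cell0 x by (simp add: corner0 dyadic_cell_def)
        have "d ^ Suc k * A \<le> d * A"
          using d \<open>0 < A\<close> power_le_one[of d k] by (simp add: mult_left_le)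
        then have "w x < d * A" using x by (simp add: X_def)
        then obtain j where "cube_mean w (dyadic_corner a l j (dyadic_index a l j x)) (l / 2 ^ j) < K ^ CARD('n) * (d * A)"
          using lim by blast
        then have "stop j (dyadic_index a l j x)"
          by (simp add: stop_def side_def n_def[symmetric] mult.assoc[symmetric] d(3))
        then have "\<exists>j. stop j (dyadic_index a l j x) \<and> (\<forall>i<j. \<not> stop i (dyadic_index a l i x))"
          by (rule exists_least_iff[THEN iffD1, OF exI])
        then obtain j where "stop j (dyadic_index a l j x)" "\<forall>i<j. \<not> stop i (dyadic_index a l i x)"
          by blast
        with 0 have "(j, dyadic_index a l j x) \<in> J"
          unfolding J_def by blast
        then show "x \<in> (\<Union>p\<in>J. cell p \<inter> X)"
          using x by (intro UN_I[of "(j, dyadic_index a l j x)"]) (auto simp: cell_def dyadic_cell_def)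
      qed
    qed
    then have "emeasure lebesgue (cube a l \<inter> X) \<le> emeasure lebesgue (\<Union>p\<in>J. cell p \<inter> X)"
      by (rule emeasure_mono_AE) (intro sets.countable_UN', auto)
    also have "\<dots> \<le> ennreal ((1 / 2) ^ k) * emeasure lebesgue E"
      unfolding E_def
    proof (rule emeasure_disjoint_UN_le[OF _ _ _ disj _ cell_bound])
      show "disjoint_family_on (\<lambda>p. cell p \<inter> X) J"
        using disj unfolding disjoint_family_on_def by blast
    qed auto
    also have "\<dots> \<le> ennreal ((1 / 2) ^ k) * ennreal (l ^ n / 2)"
      by (intro mult_left_mono E_half) simp
    also have "\<dots> = ennreal ((1 / 2) ^ Suc k * l ^ CARD('n))"
      using l by (simp add: n_def flip: ennreal_mult)
    finally show ?thesis
      unfolding goal_eq .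
  qed
qed

section \<open>Comparability on halves and the Muckenhoupt condition\<close>

lemma emeasure_weighted:
  assumes "weight w" "S \<in> sets lebesgue"
  shows "emeasure (weighted w) S = (\<integral>\<^sup>+x\<in>S. ennreal (w x) \<partial>lebesgue)"
  using assms by (subst emeasure_density) (auto simp: weight_def)

lemma average_weight_cube:
  fixes w :: "real ^ 'n \<Rightarrow> real"
  assumes w: "weight w" "comparable_on_halves w K" and l: "0 < l"
  shows "average (\<lambda>x. ennreal (w x)) (cube a l) = ennreal (cube_mean w a l)"
  using l emeasure_eq_measure2[OF cube_measurable_weighted[OF w l, of a]]
  by (simp add: average_def cube_mean_def emeasure_cube emeasure_weighted[OF w(1), symmetric] divide_ennreal
      del: emeasure_completion)

lemma emeasure_weighted_eq_average:
  assumes w: "weight w" and Q: "Q \<in> cubes"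
  shows "emeasure (weighted w) Q = emeasure lebesgue Q * average (\<lambda>x. ennreal (w x)) Q"
proof -
  obtain a l where al: "Q = cube a l" "0 < l"
    using Q by (auto simp: cubes_eq)
  define q where "q = emeasure lebesgue Q"
  have "q \<noteq> 0" "q \<noteq> top"
    using al by (auto simp: q_def emeasure_cube simp del: emeasure_completion)
  moreover have "emeasure (weighted w) Q = (\<integral>\<^sup>+x\<in>Q. ennreal (w x) \<partial>lebesgue)"
    using al by (simp add: emeasure_weighted[OF w])
  ultimately show ?thesis
    unfolding average_def q_def[symmetric]
    by (simp add: ennreal_times_divide mult_divide_eq_ennreal mult.commute[of q])
qed

text \<open>
  Decomposition of the dual weight along the levels \<open>d ^ k * A\<close>, for the exponent \<open>p\<close> with
  \<open>1 / (p - 1) = \<epsilon>\<close>. A positive value \<open>w x\<close> is at least \<open>d ^ k * A\<close> for a first \<open>k\<close>; if \<open>k > 0\<close>, then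
  the term of index \<open>k - 1\<close> alone suffices. Where \<open>w\<close> vanishes all terms are present and the series
  diverges, as it must.
\<close>

lemma dual_weight_le_suminf:
  assumes "0 \<le> w x" "0 < A" "0 < d" "d < 1" "0 < \<epsilon>" and \<epsilon>: "d powr - \<epsilon> = 3 / 2"
  shows "dual_weight (1 + 1 / \<epsilon>) w x \<le> ennreal (A powr - \<epsilon>) *
    (1 + (\<Sum>k. ennreal ((3 / 2) ^ Suc k) * indicator {x. w x < d ^ k * A} x))" (is "_ \<le> _ * (1 + (\<Sum>k. ?t k))")
proof (cases "w x = 0")
  case True
  have "(1 :: ennreal) \<le> ?t k" for k
  proof -
    have "(1 :: ennreal) \<le> ennreal ((3 / 2) ^ Suc k)"
      unfolding ennreal_1[symmetric] by (intro ennreal_leI one_le_power) simp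
    then show ?thesis using True assms by (simp del: power_Suc)
  qed
  then have "of_nat n \<le> (\<Sum>k<n. ?t k)" for n
    using sum_mono[of "{..<n}" "\<lambda>_. 1 :: ennreal" ?t] by simp
  then have "of_nat n \<le> (\<Sum>k. ?t k)" for n
    using sum_le_suminf[of ?t "{..<n}"] by (meson finite_lessThan order_trans summableI zero_le)
  then have "(\<Sum>k. ?t k) = top"
    by (rule ennreal_eq_top_if_of_nat_le)
  then show ?thesis using assms by (simp add: ennreal_mult_top)
next
  case False
  with assms have "0 < w x" by simp
  then have dual: "dual_weight (1 + 1 / \<epsilon>) w x = ennreal (w x powr - \<epsilon>)"
    using assms by (simp add: dual_weight_def inverse_ennreal ennpowr_ennreal powr_minus inverse_powr)
  have pow: "(d ^ k) powr - \<epsilon> = (3 / 2) ^ k" for k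
    using assms by (simp add: \<epsilon>[symmetric] powr_power powr_realpow[symmetric] powr_powr mult.commute)
  show ?thesis
  proof (cases "w x < A")
    case True
    obtain k where "d ^ k < w x / A"
      using real_arch_pow_inv[of "w x / A" d] \<open>0 < w x\<close> assms by auto
    then have "d ^ k * A < w x"
      using assms by (simp add: field_simps)
    then have ex: "\<exists>k. d ^ k * A \<le> w x" by (auto intro: less_imp_le)
    define k where "k = (LEAST k. d ^ k * A \<le> w x)"
    have k: "d ^ k * A \<le> w x" "\<And>i. i < k \<Longrightarrow> w x < d ^ i * A"
      using LeastI_ex[OF ex] not_less_Least[of _ "\<lambda>k. d ^ k * A \<le> w x"] by (auto simp: k_def not_le)
    have "k \<noteq> 0" using k(1) True by (metis mult_1 not_le power_0)
    then obtain j where j: "k = Suc j" by (cases k) auto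
    have "w x powr - \<epsilon> \<le> (d ^ k * A) powr - \<epsilon>"
      using k(1) assms by (intro powr_mono2') auto
    also have "\<dots> = A powr - \<epsilon> * (3 / 2) ^ Suc j"
      using assms by (simp add: powr_mult pow[of "Suc j"] j mult.commute del: power_Suc)
    finally have "dual_weight (1 + 1 / \<epsilon>) w x \<le> ennreal (A powr - \<epsilon>) * ?t j"
      using k(2)[of j] j unfolding dual by (simp add: ennreal_leI flip: ennreal_mult)
    also have "?t j \<le> (\<Sum>k. ?t k)"
      by (rule ennreal_le_suminf)
    also have "\<dots> \<le> 1 + (\<Sum>k. ?t k)" by simp
    finally show ?thesis by (simp add: mult_left_mono)
  next
    case False
    then have "dual_weight (1 + 1 / \<epsilon>) w x \<le> ennreal (A powr - \<epsilon>) * 1"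
      using assms unfolding dual by (simp add: ennreal_leI powr_mono2')
    also have "\<dots> \<le> ennreal (A powr - \<epsilon>) * (1 + (\<Sum>k. ?t k))"
      by (intro mult_left_mono) auto
    finally show ?thesis .
  qed
qed

text \<open>
  The exponent \<open>\<epsilon>\<close> is chosen such that passing to the next level multiplies \<open>w powr - \<epsilon>\<close> by \<open>3 / 2\<close> only,
  while the measure of the sublevel set is halved. The resulting series has ratio \<open>3 / 4\<close>, and its sum
  bounds the mean of the dual weight on a cube where \<open>w\<close> has mean \<open>A\<close> by \<open>7 * A powr - \<epsilon>\<close>.
\<close>

lemma comparable_on_halves_imp_A_infinity:
  fixes w :: "real ^ 'n \<Rightarrow> real"
  assumes w: "weight w" "comparable_on_halves w K"
  shows "w \<in> A_infinity"
proof -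
  have [measurable]: "w \<in> borel_measurable lebesgue" and nn: "\<And>x. 0 \<le> w x"
    using w(1) by (auto simp: weight_def)
  define d where "d = 1 / (2 * K ^ Suc CARD('n))"
  have "1 \<le> K ^ Suc CARD('n)"
    using w(2) by (intro one_le_power) (simp add: comparable_on_halves_def)
  then have d: "0 < d" "d < 1" by (auto simp: d_def)
  \<comment> \<open>Any value of \<open>d powr - \<epsilon>\<close> strictly between \<open>1\<close> and \<open>2\<close> would do.\<close>
  define \<epsilon> where "\<epsilon> = ln (3 / 2) / ln (1 / d)"
  have "0 < \<epsilon>" using d by (simp add: \<epsilon>_def)
  have \<epsilon>: "d powr - \<epsilon> = 3 / 2"
  proof -
    have "- \<epsilon> * ln d = ln (3 / 2)"
      using d by (simp add: \<epsilon>_def ln_div)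
    then show ?thesis using d by (simp add: powr_def)
  qed
  define p where "p = 1 + 1 / \<epsilon>"
  have p: "1 < p" "p - 1 = 1 / \<epsilon>" using \<open>0 < \<epsilon>\<close> by (auto simp: p_def)
  have "average (\<lambda>x. ennreal (w x)) Q * ennpowr (average (dual_weight p w) Q) (p - 1) \<le> ennreal (7 powr (1 / \<epsilon>))"
    if "Q \<in> cubes" for Q
  proof -
    obtain a l where Q: "Q = cube a l" "0 < l"
      using \<open>Q \<in> cubes\<close> by (auto simp: cubes_eq)
    define A where "A = cube_mean w a l"
    have avg: "average (\<lambda>x. ennreal (w x)) Q = ennreal A"
      using average_weight_cube[OF w] Q by (simp add: A_def)
    show ?thesis
    proof (cases "A = 0")
      case False
      then have "0 < A"
        using Q(2) by (simp add: A_def cube_mean_def less_le)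
      define L where "L k = {x. w x < d ^ k * A}" for k
      have L [measurable]: "L k \<in> sets lebesgue" for k
      proof -
        have "L k = w -` {..<d ^ k * A} \<inter> space lebesgue" by (auto simp: L_def)
        then show ?thesis by (simp only:) (rule measurable_sets[of w lebesgue borel], auto)
      qed
      have L_le: "emeasure lebesgue (L k \<inter> Q) \<le> ennreal ((1 / 2) ^ k * l ^ CARD('n))" for k
      proof -
        have "L k \<inter> Q = {x \<in> cube a l. w x < (1 / (2 * K ^ Suc CARD('n))) ^ k * cube_mean w a l}"
          by (auto simp: L_def Q(1) d_def A_def)
        then show ?thesis using emeasure_sublevel_decay[OF w Q(2), of a k] by (simp only:)
      qed
      have "(\<integral>\<^sup>+x\<in>Q. dual_weight p w x \<partial>lebesgue)
          \<le> (\<integral>\<^sup>+x. ennreal (A powr - \<epsilon>) * (indicator Q x + (\<Sum>k. ennreal ((3 / 2) ^ Suc k) * indicator (L k \<inter> Q) x)) \<partial>lebesgue)"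
      proof (rule nn_integral_mono)
        fix x
        show "dual_weight p w x * indicator Q x
            \<le> ennreal (A powr - \<epsilon>) * (indicator Q x + (\<Sum>k. ennreal ((3 / 2) ^ Suc k) * indicator (L k \<inter> Q) x))"
          using dual_weight_le_suminf[of w x A d \<epsilon>, OF nn \<open>0 < A\<close> d \<open>0 < \<epsilon>\<close> \<epsilon>]
          by (cases "x \<in> Q") (simp_all add: p_def L_def indicator_inter_arith)
      qed
      also have "\<dots> = ennreal (A powr - \<epsilon>) * (emeasure lebesgue Q + (\<Sum>k. ennreal ((3 / 2) ^ Suc k) * emeasure lebesgue (L k \<inter> Q)))"
        using Q by (simp add: nn_integral_cmult nn_integral_add nn_integral_suminf nn_integral_cmult_indicator del: emeasure_completion power_Suc)
      also have "\<dots> \<le> ennreal (A powr - \<epsilon>) * (ennreal (l ^ CARD('n)) + (\<Sum>k. ennreal ((3 / 2) ^ Suc k) * ennreal ((1 / 2) ^ k * l ^ CARD('n))))"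
        using L_le Q by (intro mult_left_mono add_mono suminf_le summableI) (auto simp: emeasure_cube simp del: emeasure_completion)
      also have "(\<Sum>k. ennreal ((3 / 2) ^ Suc k) * ennreal ((1 / 2) ^ k * l ^ CARD('n))) = ennreal (6 * l ^ CARD('n))"
      proof -
        have "(\<lambda>k. 3 / 2 * l ^ CARD('n) * (3 / 4 :: real) ^ k) sums (3 / 2 * l ^ CARD('n) * (1 / (1 - 3 / 4)))"
          by (intro sums_mult geometric_sums) simp
        then have sums: "(\<lambda>k. 3 / 2 * l ^ CARD('n) * (3 / 4 :: real) ^ k) sums (6 * l ^ CARD('n))"
          by simp
        have "ennreal ((3 / 2) ^ Suc k) * ennreal ((1 / 2) ^ k * l ^ CARD('n)) = ennreal (3 / 2 * l ^ CARD('n) * (3 / 4) ^ k)" for k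
        proof -
          have "(3 / 4 :: real) ^ k = (3 / 2) ^ k * (1 / 2) ^ k"
            by (simp flip: power_mult_distrib)
          then show ?thesis using Q(2) by (simp add: ennreal_mult[symmetric] mult_ac)
        qed
        then show ?thesis
          using sums Q(2) by (simp only:) (intro suminf_ennreal_eq, auto)
      qed
      also have "ennreal (A powr - \<epsilon>) * (ennreal (l ^ CARD('n)) + ennreal (6 * l ^ CARD('n))) = ennreal (7 * A powr - \<epsilon> * l ^ CARD('n))"
        using Q(2) by (simp add: ennreal_mult[symmetric] ennreal_plus[symmetric] mult_ac del: ennreal_plus)
      finally have "average (dual_weight p w) Q \<le> ennreal (7 * A powr - \<epsilon> * l ^ CARD('n)) / ennreal (l ^ CARD('n))"
        unfolding average_def using Q by (simp add: emeasure_cube divide_right_mono_ennreal del: emeasure_completion)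
      also have "\<dots> = ennreal (7 * A powr - \<epsilon>)"
        using Q(2) by (simp add: divide_ennreal)
      finally have "ennpowr (average (dual_weight p w) Q) (p - 1) \<le> ennpowr (ennreal (7 * A powr - \<epsilon>)) (p - 1)"
        using \<open>0 < \<epsilon>\<close> p by (intro ennpowr_mono) auto
      also have "\<dots> = ennreal (7 powr (1 / \<epsilon>) / A)"
      proof -
        have "(7 * A powr - \<epsilon>) powr (1 / \<epsilon>) = 7 powr (1 / \<epsilon>) * A powr (- \<epsilon> * (1 / \<epsilon>))"
          by (simp only: powr_mult powr_powr)
        also have "\<dots> = 7 powr (1 / \<epsilon>) / A"
          using \<open>0 < A\<close> \<open>0 < \<epsilon>\<close> by (simp add: powr_minus_divide)
        finally show ?thesis
          by (simp only: p(2)) (subst ennpowr_ennreal, auto)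
      qed
      finally have "average (\<lambda>x. ennreal (w x)) Q * ennpowr (average (dual_weight p w) Q) (p - 1)
          \<le> ennreal A * ennreal (7 powr (1 / \<epsilon>) / A)"
        unfolding avg by (rule mult_left_mono) simp
      also have "\<dots> = ennreal (7 powr (1 / \<epsilon>))"
        using \<open>0 < A\<close> by (simp flip: ennreal_mult)
      finally show ?thesis .
    qed (simp add: avg)
  qed
  then have "Ap_const p w \<le> ennreal (7 powr (1 / \<epsilon>))"
    unfolding Ap_const_def by (rule SUP_least)
  then have "Ap_const p w < \<infinity>"
    by (rule order_le_less_trans) simp
  then have "w \<in> A_class p"
    using w(1) p(1) by (simp add: A_class_def)
  then show ?thesis
    using p(1) by (auto simp: A_infinity_def intro!: bexI[of _ p])
qed

text \<open>
  Common end of the cases \<open>p = 1\<close> and \<open>p > 1\<close> below: on \<open>F\<close> the weight is at least \<open>1 / T\<close>, its mean on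
  \<open>Q\<close> is at most \<open>c / T\<close>, and \<open>F\<close> is at least a quarter of \<open>Q\<close>.
\<close>

lemma weighted_le_of_bound_below:
  fixes w :: "real ^ 'n \<Rightarrow> real"
  assumes w: "weight w" and Q: "Q \<in> cubes" and F: "F \<in> sets lebesgue" "F \<subseteq> E" "E \<in> sets lebesgue"
    and large: "emeasure lebesgue Q \<le> 4 * emeasure lebesgue F"
    and below: "AE x in lebesgue. x \<in> F \<longrightarrow> 1 \<le> T * ennreal (w x)"
    and T: "average (\<lambda>x. ennreal (w x)) Q * T \<le> c"
  shows "emeasure (weighted w) Q \<le> 4 * c * emeasure (weighted w) E"
proof -
  have [measurable]: "w \<in> borel_measurable lebesgue" "F \<in> sets lebesgue"
    using w F by (auto simp: weight_def)
  obtain a l where al: "Q = cube a l" "0 < l"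
    using Q by (auto simp: cubes_eq)
  define q where "q = l ^ CARD('n)"
  have q: "0 < q" "emeasure lebesgue Q = ennreal q"
    using al by (auto simp: q_def emeasure_cube simp del: emeasure_completion)
  have wQ: "emeasure (weighted w) Q = ennreal q * average (\<lambda>x. ennreal (w x)) Q"
    using emeasure_weighted_eq_average[OF w Q] q(2) by simp
  have "emeasure lebesgue F = (\<integral>\<^sup>+x. indicator F x \<partial>lebesgue)"
    by (simp del: emeasure_completion)
  also have "\<dots> \<le> (\<integral>\<^sup>+x. T * (ennreal (w x) * indicator F x) \<partial>lebesgue)"
    using below by (intro nn_integral_mono_AE) (auto elim!: eventually_mono split: split_indicator)
  also have "\<dots> = T * emeasure (weighted w) F"
    by (simp add: nn_integral_cmult emeasure_weighted[OF w])
  finally have F_le: "emeasure lebesgue F \<le> T * emeasure (weighted w) F" .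
  have "emeasure (weighted w) Q * ennreal q \<le> emeasure (weighted w) Q * (4 * (T * emeasure (weighted w) F))"
  proof (rule mult_left_mono)
    have "4 * emeasure lebesgue F \<le> 4 * (T * emeasure (weighted w) F)"
      using F_le by (rule mult_left_mono) simp
    with large q(2) show "ennreal q \<le> 4 * (T * emeasure (weighted w) F)"
      by (metis order_trans)
  qed simp
  also have "\<dots> = ennreal q * (4 * (average (\<lambda>x. ennreal (w x)) Q * T) * emeasure (weighted w) F)"
    unfolding wQ by (simp only: mult_ac)
  also have "\<dots> \<le> ennreal q * (4 * c * emeasure (weighted w) E)"
    using T F by (intro mult_left_mono mult_mono emeasure_mono) auto
  finally have "ennreal q * emeasure (weighted w) Q \<le> ennreal q * (4 * c * emeasure (weighted w) E)"
    by (simp only: mult.commute)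
  then show ?thesis
    using q(1) by (subst (asm) ennreal_mult_le_mult_iff) auto
qed

lemma one_le_ennreal_mult:
  assumes "inverse (ennreal r) \<le> T" "T \<noteq> \<infinity>" "0 \<le> r"
  shows "1 \<le> T * ennreal r"
proof (cases "r = 0")
  case False
  then have "1 = inverse (ennreal r) * ennreal r"
    using assms by (simp add: inverse_ennreal flip: ennreal_mult)
  also have "\<dots> \<le> T * ennreal r"
    using assms by (intro mult_right_mono) auto
  finally show ?thesis .
qed (use assms in \<open>simp add: top_unique\<close>)

text \<open>
  For \<open>p = 1\<close> the reciprocal of \<open>w\<close> is bounded on \<open>Q\<close> by its essential supremum. For \<open>p > 1\<close> let \<open>s\<close> be the
  mean of the dual weight: by Chebyshev's inequality it exceeds \<open>4 * s\<close> on at most a quarter of \<open>Q\<close>, and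
  outside that set \<open>1 / w\<close> is bounded by \<open>(4 * s) powr (p - 1)\<close>. A half of \<open>Q\<close> keeps at least a quarter
  after the exceptional set is removed.
\<close>

lemma A_infinity_imp_comparable_on_halves:
  fixes w :: "real ^ 'n \<Rightarrow> real"
  assumes "w \<in> A_infinity"
  shows "\<exists>K. comparable_on_halves w K"
proof -
  obtain p where p: "1 \<le> p" "w \<in> A_class p"
    using assms by (auto simp: A_infinity_def)
  then have w: "weight w" by (simp add: A_class_def)
  have [measurable]: "w \<in> borel_measurable lebesgue" and nn: "\<And>x. 0 \<le> w x"
    using w by (auto simp: weight_def)
  have large: "emeasure lebesgue Q \<le> 2 * emeasure lebesgue E"
    if "Q \<in> cubes" "E \<in> sets lebesgue" "E \<subseteq> Q" "measure lebesgue Q / 2 \<le> measure lebesgue E" for Q E :: "(real ^ 'n) set"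
  proof -
    have "Q \<in> lmeasurable" using that(1) by (auto simp: cubes_eq)
    then have "E \<in> lmeasurable" using that(2,3) by (blast intro: fmeasurableI2)
    then show ?thesis
      using that \<open>Q \<in> lmeasurable\<close> by (simp add: emeasure_eq_measure2 ennreal_leI del: emeasure_completion flip: ennreal_mult ennreal_numeral)
  qed
  have "\<exists>c. c < \<infinity> \<and> (\<forall>Q\<in>cubes. \<forall>E\<in>sets lebesgue. E \<subseteq> Q \<and> measure lebesgue Q / 2 \<le> measure lebesgue E \<longrightarrow>
      emeasure (weighted w) Q \<le> 4 * c * emeasure (weighted w) E)"
  proof (cases "p = 1")
    case True
    have "A1_const w < \<infinity>" using p True by (simp add: A_class_def)
    moreover have "emeasure (weighted w) Q \<le> 4 * A1_const w * emeasure (weighted w) E"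
      if QE: "Q \<in> cubes" "E \<in> sets lebesgue" "E \<subseteq> Q" "measure lebesgue Q / 2 \<le> measure lebesgue E" for Q E
    proof (cases "emeasure (weighted w) Q = 0")
      case False
      define T where "T = esssup (restrict_space lebesgue Q) (\<lambda>x. inverse (ennreal (w x)))"
      have T: "average (\<lambda>x. ennreal (w x)) Q * T \<le> A1_const w"
        unfolding A1_const_def T_def using QE(1) by (rule SUP_upper)
      have [measurable]: "Q \<in> sets lebesgue" using QE(1) by (auto simp: cubes_eq)
      have "average (\<lambda>x. ennreal (w x)) Q \<noteq> 0"
        using False emeasure_weighted_eq_average[OF w QE(1)] by auto
      then have "T \<noteq> \<infinity>"
        using T \<open>A1_const w < \<infinity>\<close> by (auto simp: ennreal_mult_top top_unique)
      have "AE x in restrict_space lebesgue Q. inverse (ennreal (w x)) \<le> T"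
        unfolding T_def by (rule esssup_AE)
      then have "AE x in lebesgue. x \<in> Q \<longrightarrow> inverse (ennreal (w x)) \<le> T"
        by (subst (asm) AE_restrict_space_iff) auto
      then have "AE x in lebesgue. x \<in> E \<longrightarrow> 1 \<le> T * ennreal (w x)"
        using QE(3) \<open>T \<noteq> \<infinity>\<close> nn by (auto elim!: eventually_mono intro!: one_le_ennreal_mult)
      moreover have "emeasure lebesgue Q \<le> 4 * emeasure lebesgue E"
        using large[OF QE] by (rule order_trans) (intro mult_right_mono, auto)
      ultimately show ?thesis
        using QE T by (intro weighted_le_of_bound_below[OF w]) auto
    qed simp
    ultimately show ?thesis by blast
  next
    case False
    with p have "1 < p" by simp
    have Ap: "Ap_const p w < \<infinity>" using p False by (simp add: A_class_def)
    define c where "c = ennpowr 4 (p - 1) * Ap_const p w"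
    have "c < \<infinity>"
      using Ap \<open>1 < p\<close> ennpowr_ennreal[of 4 "p - 1"] by (simp add: c_def ennreal_mult_less_top)
    moreover have "emeasure (weighted w) Q \<le> 4 * c * emeasure (weighted w) E"
      if QE: "Q \<in> cubes" "E \<in> sets lebesgue" "E \<subseteq> Q" "measure lebesgue Q / 2 \<le> measure lebesgue E" for Q E
    proof (cases "emeasure (weighted w) Q = 0")
      case False
      define s where "s = average (dual_weight p w) Q"
      define T where "T = ennpowr (4 * s) (p - 1)"
      have [measurable]: "Q \<in> sets lebesgue" "E \<in> sets lebesgue" using QE by (auto simp: cubes_eq)
      have [measurable]: "dual_weight p w \<in> borel_measurable lebesgue"
        unfolding dual_weight_def by measurable
      have Ts: "T = ennpowr 4 (p - 1) * ennpowr s (p - 1)"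
        using \<open>1 < p\<close> by (simp add: T_def ennpowr_mult)
      have s: "average (\<lambda>x. ennreal (w x)) Q * ennpowr s (p - 1) \<le> Ap_const p w"
        unfolding Ap_const_def s_def using QE(1) by (rule SUP_upper)
      then have T: "average (\<lambda>x. ennreal (w x)) Q * T \<le> c"
        unfolding Ts c_def by (subst mult.left_commute) (rule mult_left_mono, simp_all)
      have "average (\<lambda>x. ennreal (w x)) Q \<noteq> 0"
        using False emeasure_weighted_eq_average[OF w QE(1)] by auto
      then have "T \<noteq> \<infinity>"
        using T \<open>c < \<infinity>\<close> by (auto simp: ennreal_mult_top top_unique)
      then have "s \<noteq> \<infinity>"
        by (auto simp: T_def ennpowr_def ennreal_mult_top)
      obtain q where q: "0 < q" "emeasure lebesgue Q = ennreal q"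
      proof -
        obtain a l where "Q = cube a l" "0 < l"
          using QE(1) by (auto simp: cubes_eq)
        then show thesis
          by (intro that[of "l ^ CARD('n)"]) (simp_all add: emeasure_cube del: emeasure_completion)
      qed
      define B where "B = {x \<in> Q. 4 * s < dual_weight p w x}"
      have [measurable]: "B \<in> sets lebesgue" unfolding B_def by measurable
      have int: "(\<integral>\<^sup>+x\<in>Q. dual_weight p w x \<partial>lebesgue) = s * ennreal q"
        unfolding s_def average_def q using q(1) by (simp add: ennreal_divide_times mult_divide_eq_ennreal)
      have B: "4 * emeasure lebesgue B \<le> ennreal q"
      proof (cases "s = 0")
        case True
        then have "AE x in lebesgue. dual_weight p w x * indicator Q x = 0"
          using int by (simp add: nn_integral_0_iff_AE)
        then have "AE x in lebesgue. x \<notin> B"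
          by (auto simp: B_def elim!: eventually_mono split: split_indicator_asm)
        then have "emeasure lebesgue B = 0"
          by (subst (asm) AE_iff_measurable[of B]) auto
        then show ?thesis by simp
      next
        case False
        have "s * (4 * emeasure lebesgue B) = (\<integral>\<^sup>+x. (4 * s) * indicator B x \<partial>lebesgue)"
          by (subst nn_integral_cmult_indicator) (auto simp: mult_ac simp del: emeasure_completion)
        also have "\<dots> \<le> (\<integral>\<^sup>+x\<in>Q. dual_weight p w x \<partial>lebesgue)"
          by (intro nn_integral_mono) (auto simp: B_def less_imp_le split: split_indicator)
        finally show ?thesis
          unfolding int using False \<open>s \<noteq> \<infinity>\<close> by (subst (asm) ennreal_mult_le_mult_iff) auto
      qed
      define F where "F = E - B"
      have [measurable]: "F \<in> sets lebesgue" unfolding F_def by measurable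
      have "emeasure lebesgue Q \<le> 4 * emeasure lebesgue F"
      proof -
        have Qf: "Q \<in> lmeasurable" using QE(1) by (auto simp: cubes_eq)
        have E: "E \<in> lmeasurable" using QE(2,3) Qf by (blast intro: fmeasurableI2)
        have Bf: "B \<in> lmeasurable" using Qf by (rule fmeasurableI2) (auto simp: B_def)
        have "measure lebesgue Q = q"
          using q by (simp add: measure_def del: emeasure_completion)
        moreover have "4 * measure lebesgue B \<le> q"
          using B q(1) by (simp add: emeasure_eq_measure2[OF Bf] del: emeasure_completion flip: ennreal_mult ennreal_numeral)
        moreover have "measure lebesgue E \<le> measure lebesgue F + measure lebesgue B"
          using E Bf measure_Un_le[of F lebesgue B] measure_mono_fmeasurable[of E "F \<union> B" lebesgue]
          by (simp add: F_def fmeasurable.Un fmeasurable_Diff) 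
        ultimately have "q \<le> 4 * measure lebesgue F"
          using QE(4) by linarith
        moreover have "F \<in> lmeasurable" using E Bf by (simp add: F_def fmeasurable_Diff)
        ultimately show ?thesis
          by (simp add: q emeasure_eq_measure2 ennreal_leI del: emeasure_completion flip: ennreal_mult ennreal_numeral)
      qed
      moreover have "1 \<le> T * ennreal (w x)" if "x \<in> F" for x
      proof (rule one_le_ennreal_mult)
        have "dual_weight p w x \<le> 4 * s"
          using that QE(3) by (auto simp: F_def B_def not_less)
        then have "ennpowr (dual_weight p w x) (p - 1) \<le> T"
          unfolding T_def using \<open>1 < p\<close> by (intro ennpowr_mono) auto
        then show "inverse (ennreal (w x)) \<le> T"
          using \<open>1 < p\<close> by (simp add: dual_weight_def ennpowr_ennpowr)
      qed (use \<open>T \<noteq> \<infinity>\<close> nn in auto)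
      ultimately show ?thesis
        using QE T by (intro weighted_le_of_bound_below[OF w, of Q F E T]) (auto simp: F_def)
    qed simp
    ultimately show ?thesis by blast
  qed
  then obtain c where c: "c < \<infinity>" "\<And>Q E. Q \<in> cubes \<Longrightarrow> E \<in> sets lebesgue \<Longrightarrow> E \<subseteq> Q \<Longrightarrow>
      measure lebesgue Q / 2 \<le> measure lebesgue E \<Longrightarrow> emeasure (weighted w) Q \<le> 4 * c * emeasure (weighted w) E"
    by blast
  define K where "K = max 1 (enn2real (4 * c))"
  have "4 * c = ennreal (enn2real (4 * c))"
    using c(1) by (simp add: ennreal_mult_less_top)
  also have "\<dots> \<le> ennreal K"
    by (intro ennreal_leI) (simp add: K_def)
  finally have "4 * c \<le> ennreal K" .
  then have "comparable_on_halves w K"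
    unfolding comparable_on_halves_def
  proof (intro conjI ballI impI; (elim conjE)?)
    fix Q E :: "(real ^ 'n) set"
    assume "Q \<in> cubes" "E \<in> sets lebesgue" "E \<subseteq> Q" "measure lebesgue Q / 2 \<le> measure lebesgue E"
    then have "emeasure (weighted w) Q \<le> 4 * c * emeasure (weighted w) E"
      by (rule c(2))
    also have "\<dots> \<le> ennreal K * emeasure (weighted w) E"
      using \<open>4 * c \<le> ennreal K\<close> by (rule mult_right_mono) simp
    finally show "emeasure (weighted w) Q \<le> ennreal K * emeasure (weighted w) E" .
  qed (simp add: K_def)
  then show ?thesis ..
qed

section \<open>Comparability on halves and boundedness\<close>

text \<open>
  Test the operator on the indicator of \<open>E\<close>: its maximal function is at least \<open>1\<close> on \<open>Q\<close>.
\<close>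

lemma bounded_imp_comparable_on_halves:
  fixes w :: "real ^ 'n \<Rightarrow> real"
  assumes w: "weight w" and "0 < p" "0 \<le> C"
    and bounded: "\<And>f. f \<in> Lp_space w p \<Longrightarrow>
      Lp_norm w p (median_maximal f) \<le> ennreal C * Lp_norm w p (\<lambda>x. ennreal \<bar>f x\<bar>)"
  shows "comparable_on_halves w (max 1 (C powr p))"
  unfolding comparable_on_halves_def
proof (intro conjI ballI impI; (elim conjE)?)
  fix Q E :: "(real ^ 'n) set"
  assume Q: "Q \<in> cubes" and E: "E \<in> sets lebesgue" "E \<subseteq> Q" "measure lebesgue Q / 2 \<le> measure lebesgue E"
  obtain a l where al: "Q = cube a l" "0 < l"
    using Q by (auto simp: cubes_eq)
  have ind: "ennpowr (ennreal \<bar>indicator S x\<bar>) p * ennreal (w x) = ennreal (w x) * indicator S x" for S x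
    using \<open>0 < p\<close> by (auto simp: ennpowr_def split: split_indicator)
  have norm_E: "Lp_norm w p (\<lambda>x. ennreal \<bar>indicator E x\<bar>) = ennpowr (emeasure (weighted w) E) (1 / p)"
    unfolding Lp_norm_def ind using E(1) by (simp add: emeasure_weighted[OF w])
  show "emeasure (weighted w) Q \<le> ennreal (max 1 (C powr p)) * emeasure (weighted w) E"
  proof (cases "emeasure (weighted w) E = \<infinity>")
    case True
    then show ?thesis by (simp add: ennreal_mult_top)
  next
    case False
    have "indicator E \<in> Lp_space w p"
      unfolding Lp_space_def mem_Collect_eq norm_E using E(1) False by (simp add: ennpowr_def less_top)
    have "ennreal (indicator Q x) \<le> median_maximal (indicator E) x" for x
    proof (cases "x \<in> Q")
      case True
      have "\<bar>max_median (indicator E) Q\<bar> = 1"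
        using E al by (intro max_median_indicator) (auto simp: measure_cube)
      then show ?thesis
        using True Q unfolding median_maximal_def by (intro SUP_upper2[of Q]) auto
    qed simp
    then have "(\<integral>\<^sup>+x. ennpowr (ennreal \<bar>indicator Q x\<bar>) p * ennreal (w x) \<partial>lebesgue)
        \<le> (\<integral>\<^sup>+x. ennpowr (median_maximal (indicator E) x) p * ennreal (w x) \<partial>lebesgue)"
      using \<open>0 < p\<close> by (intro nn_integral_mono mult_right_mono ennpowr_mono) auto
    then have "ennpowr (emeasure (weighted w) Q) (1 / p) \<le> Lp_norm w p (median_maximal (indicator E))"
      unfolding Lp_norm_def ind using \<open>0 < p\<close> al by (intro ennpowr_mono) (auto simp: emeasure_weighted[OF w])
    also have "\<dots> \<le> ennreal C * ennpowr (emeasure (weighted w) E) (1 / p)"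
      using bounded[OF \<open>indicator E \<in> Lp_space w p\<close>] by (simp only: norm_E)
    finally have "ennpowr (ennpowr (emeasure (weighted w) Q) (1 / p)) p
        \<le> ennpowr (ennreal C * ennpowr (emeasure (weighted w) E) (1 / p)) p"
      using \<open>0 < p\<close> by (intro ennpowr_mono)
    also have "\<dots> = ennreal (C powr p) * emeasure (weighted w) E"
      using \<open>0 < p\<close> \<open>0 \<le> C\<close> by (simp add: ennpowr_mult ennpowr_ennpowr ennpowr_ennreal)
    also have "\<dots> \<le> ennreal (max 1 (C powr p)) * emeasure (weighted w) E"
      by (intro mult_right_mono ennreal_leI) auto
    finally show ?thesis
      using \<open>0 < p\<close> by (simp add: ennpowr_ennpowr)
  qed
qed simp

text \<open>
  A point with \<open>median_maximal f x > s\<close> lies in a cube \<open>Q\<close> on half of which \<open>\<bar>f\<bar> > s\<close>; so the weighted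
  measure of \<open>Q\<close> is controlled by that of its part in \<open>{\<bar>f\<bar> > s}\<close>, and covering gives a weak-type
  inequality with the same level \<open>s\<close> on both sides. For this reason the inequality passes to the
  \<open>p\<close>-th powers for every \<open>p > 0\<close>.
\<close>

lemma comparable_on_halves_imp_bounded:
  fixes w :: "real ^ 'n \<Rightarrow> real"
  assumes w: "weight w" "comparable_on_halves w K" and "0 < p" and f: "f \<in> borel_measurable lebesgue"
  shows "Lp_norm w p (median_maximal f)
    \<le> ennreal ((4 * K ^ (3 * CARD('n) + 1)) powr (1 / p)) * Lp_norm w p (\<lambda>x. ennreal \<bar>f x\<bar>)"
proof -
  have [measurable]: "w \<in> borel_measurable lebesgue" "f \<in> borel_measurable lebesgue"
    using w(1) f by (auto simp: weight_def)
  have K: "1 \<le> K" using w(2) by (simp add: comparable_on_halves_def)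
  define D where "D = K ^ (3 * CARD('n) + 1)"
  have "0 \<le> D" using K by (simp add: D_def)
  define g where "g x = ennpowr (ennreal \<bar>f x\<bar>) p" for x
  define h where "h x = ennpowr (median_maximal f x) p" for x
  have [measurable]: "g \<in> borel_measurable lebesgue"
    unfolding g_def by measurable
  obtain H where H: "H \<in> borel_measurable (weighted w)" "\<And>x. x \<in> space (weighted w) \<Longrightarrow> h x \<le> H x"
    "(\<integral>\<^sup>+x. H x \<partial>weighted w) \<le> 4 * ennreal D * (\<integral>\<^sup>+x. g x \<partial>weighted w)"
  proof (rule weak_type_imp_nn_integral_le[of g "weighted w" h "ennreal D"])
    fix t :: real assume "0 < t"
    define s where "s = t powr (1 / p)"
    define S where "S = {x. s < \<bar>f x\<bar>}"
    have S: "{x \<in> space (weighted w). ennreal t < g x} = S"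
      using \<open>0 < t\<close> \<open>0 < p\<close> by (auto simp: g_def S_def ennreal_less_ennpowr_iff s_def ennreal_less_iff)
    have "{x \<in> space (weighted w). ennreal t < g x} \<in> sets (weighted w)"
      by measurable
    then have "S \<in> sets lebesgue" unfolding S by simp
    define \<Q> where "\<Q> = {Q \<in> cubes. s < \<bar>max_median f Q\<bar>}"
    have sub: "{x \<in> space (weighted w). ennreal t < h x} \<subseteq> \<Union>\<Q>"
    proof
      fix x assume "x \<in> {x \<in> space (weighted w). ennreal t < h x}"
      then have "ennreal s < median_maximal f x"
        using \<open>0 < t\<close> \<open>0 < p\<close> by (simp add: h_def s_def ennreal_less_ennpowr_iff)
      then obtain Q where "Q \<in> cubes" "x \<in> Q" "ennreal s < ennreal \<bar>max_median f Q\<bar>"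
        by (auto simp: median_maximal_def less_SUP_iff)
      then show "x \<in> \<Union>\<Q>"
        by (auto simp: \<Q>_def s_def ennreal_less_iff)
    qed
    have "emeasure (weighted w) Q \<le> ennreal K * emeasure (weighted w) (Q \<inter> S)" if "Q \<in> \<Q>" for Q
    proof -
      have Q: "Q \<in> cubes" "Q \<in> lmeasurable" "0 < measure lebesgue Q" "s < \<bar>max_median f Q\<bar>"
        using that by (auto simp: \<Q>_def cubes_eq measure_cube)
      then have "measure lebesgue Q / 2 \<le> measure lebesgue (Q \<inter> S)"
        unfolding S_def by (intro half_measure_superlevel_max_median) auto
      then show ?thesis
        using Q \<open>S \<in> sets lebesgue\<close> by (intro comparable_on_halvesD[OF w(2)]) auto
    qed
    then obtain G where G: "open G" "\<Union>\<Q> \<subseteq> G" "emeasure (weighted w) G \<le> ennreal D * emeasure (weighted w) S"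
      using weighted_open_cover[OF w(2) \<open>S \<in> sets lebesgue\<close>, of \<Q>] unfolding D_def \<Q>_def by blast
    show "\<exists>V\<in>sets (weighted w). {x \<in> space (weighted w). ennreal t < h x} \<subseteq> V \<and>
        emeasure (weighted w) V \<le> ennreal D * emeasure (weighted w) {x \<in> space (weighted w). ennreal t < g x}"
      using G sub unfolding S by (intro bexI[of _ G]) auto
  qed (simp, rule that)
  have [measurable]: "H \<in> borel_measurable lebesgue" using H(1) by simp
  have "(\<integral>\<^sup>+x. h x * ennreal (w x) \<partial>lebesgue) \<le> (\<integral>\<^sup>+x. ennreal (w x) * H x \<partial>lebesgue)"
    using H(2) by (intro nn_integral_mono) (simp add: mult.commute[of _ "ennreal _"] mult_left_mono)
  also have "\<dots> = (\<integral>\<^sup>+x. H x \<partial>weighted w)"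
    by (simp add: nn_integral_density)
  also have "\<dots> \<le> ennreal (4 * D) * (\<integral>\<^sup>+x. g x \<partial>weighted w)"
    using H(3) \<open>0 \<le> D\<close> by (simp add: ennreal_mult)
  also have "(\<integral>\<^sup>+x. g x \<partial>weighted w) = (\<integral>\<^sup>+x. g x * ennreal (w x) \<partial>lebesgue)"
    by (simp add: nn_integral_density mult.commute)
  finally have "Lp_norm w p (median_maximal f) \<le> ennpowr (ennreal (4 * D) * (\<integral>\<^sup>+x. g x * ennreal (w x) \<partial>lebesgue)) (1 / p)"
    unfolding Lp_norm_def h_def using \<open>0 < p\<close> by (intro ennpowr_mono) auto
  also have "\<dots> = ennreal ((4 * D) powr (1 / p)) * Lp_norm w p (\<lambda>x. ennreal \<bar>f x\<bar>)"
    using \<open>0 < p\<close> \<open>0 \<le> D\<close> by (simp add: ennpowr_mult ennpowr_ennreal Lp_norm_def g_def)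
  finally show ?thesis by (simp add: D_def)
qed

section \<open>The characterization\<close>

theorem theorem3p8:
  fixes w :: "real ^ 'n \<Rightarrow> real" and p :: real
  assumes "weight w" and "0 < p"
  shows "(\<exists>C::real. 0 \<le> C \<and>
            (\<forall>f \<in> Lp_space w p.
               Lp_norm w p (median_maximal f) \<le> ennreal C * Lp_norm w p (\<lambda>x. ennreal \<bar>f x\<bar>)))
         \<longleftrightarrow> w \<in> A_infinity"
proof
  assume "\<exists>C::real. 0 \<le> C \<and>
    (\<forall>f \<in> Lp_space w p. Lp_norm w p (median_maximal f) \<le> ennreal C * Lp_norm w p (\<lambda>x. ennreal \<bar>f x\<bar>))"
  then obtain C where "0 \<le> C" "\<And>f. f \<in> Lp_space w p \<Longrightarrow>
      Lp_norm w p (median_maximal f) \<le> ennreal C * Lp_norm w p (\<lambda>x. ennreal \<bar>f x\<bar>)"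
    by blast
  then have "comparable_on_halves w (max 1 (C powr p))"
    using assms by (intro bounded_imp_comparable_on_halves)
  then show "w \<in> A_infinity"
    using assms(1) by (intro comparable_on_halves_imp_A_infinity)
next
  assume "w \<in> A_infinity"
  then obtain K where K: "comparable_on_halves w K"
    using A_infinity_imp_comparable_on_halves by blast
  show "\<exists>C::real. 0 \<le> C \<and>
    (\<forall>f \<in> Lp_space w p. Lp_norm w p (median_maximal f) \<le> ennreal C * Lp_norm w p (\<lambda>x. ennreal \<bar>f x\<bar>))"
  proof (intro exI conjI ballI)
    fix f assume "f \<in> Lp_space w p"
    then show "Lp_norm w p (median_maximal f)
        \<le> ennreal ((4 * K ^ (3 * CARD('n) + 1)) powr (1 / p)) * Lp_norm w p (\<lambda>x. ennreal \<bar>f x\<bar>)"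
      using assms K by (intro comparable_on_halves_imp_bounded) (auto simp: Lp_space_def)
  qed simp
qed

end
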